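(* Let $H\in(1/2,1)$ and let $B_H$ be a fractional Brownian motion of Hurst parameter $H$. Then for every $a>0$ there exists $c>0$ such that, for all sufficiently large $T$, $$c^{-1}\,T^{-(1-H)}(\log T)^{-\frac1{2H}}\le\mathbb P\left(\sup_{t\in[0,T]}B_H(t)\le a\right)\le c\,T^{-(1-H)}.$$ Moreover, the lower bound holds for any $H\in(0,1)$.
   Context: Fractional Brownian motion with Hurst parameter $H\in(0,1)$ is the real centered continuous Gaussian process $(B_H(t))_{t\ge0}$ with covariance $\mathbb E[B_H(t)B_H(s)]=\frac12\left(t^{2H}+s^{2H}-|t-s|^{2H}\right)$. *)

theory Defs
  imports "HOL-Probability.Probability"
begin

text \<open>The almost surely constant random variables are the degenerate (zero variance) normal laws.
  They have to be allowed: fractional Brownian motion vanishes at time 0, and the zero linear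
  combination occurs below.\<close>

definition (in prob_space) gaussian_rv :: "('a \<Rightarrow> real) \<Rightarrow> bool" where
  "gaussian_rv X \<longleftrightarrow> random_variable borel X \<and>
     ((\<exists>\<mu>. AE \<omega> in M. X \<omega> = \<mu>) \<or>
      (\<exists>\<mu> \<sigma>. \<sigma> > 0 \<and> distributed M lborel X (normal_density \<mu> \<sigma>)))"

definition (in prob_space) gaussian_process :: "'i set \<Rightarrow> ('i \<Rightarrow> 'a \<Rightarrow> real) \<Rightarrow> bool" where
  "gaussian_process I X \<longleftrightarrow>
     (\<forall>F c. finite F \<and> F \<subseteq> I \<longrightarrow> gaussian_rv (\<lambda>\<omega>. \<Sum>i\<in>F. c i * X i \<omega>))"

text \<open>Only the values \<open>B t\<close> with \<open>t \<ge> 0\<close> matter. Continuity is required of every sample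
  path, so path suprema over compact intervals are finite and measurable. Note \<open>0 powr (2 * H) = 0\<close>.\<close>

locale fractional_brownian_motion = prob_space M
  for M :: "'a measure" and H :: real and B :: "real \<Rightarrow> 'a \<Rightarrow> real" +
  assumes hurst_parameter: "0 < H" "H < 1"
    and gaussian: "gaussian_process {0..} B"
    and centered: "\<And>t. 0 \<le> t \<Longrightarrow> expectation (B t) = 0"
    and covariance: "\<And>s t. 0 \<le> s \<Longrightarrow> 0 \<le> t \<Longrightarrow>
      expectation (\<lambda>\<omega>. B t \<omega> * B s \<omega>) =
        1 / 2 * (t powr (2 * H) + s powr (2 * H) - \<bar>t - s\<bar> powr (2 * H))"
    and continuous_paths: "\<And>\<omega>. \<omega> \<in> space M \<Longrightarrow> continuous_on {0..} (\<lambda>t. B t \<omega>)"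

end

theory Submission
  imports Defs "HOL-Real_Asymp.Real_Asymp"
begin

text \<open>For \<open>Z k = B (k * d)\<close> the expected increment of the running maximum at time \<open>n\<close> equals, by
  stationarity of the increments and time reversal, the expectation of the positive part of
  \<open>min {Z 1, ..., Z n}\<close>. This is nonincreasing in \<open>n\<close>, while the expected running maximum grows like
  \<open>(n * d) powr H\<close>; so the expected positive part is of order \<open>(n * d) powr H / n\<close>.

  Upper bound: for \<open>H \<ge> 1 / 2\<close> the variable \<open>Z 1\<close> is nonnegatively correlated with the increments
  after it, so forcing \<open>Z 1 \<ge> 1 + a\<close> costs only a constant factor, and turns persistence above
  \<open>- a\<close> into persistence above \<open>1\<close>. Lower bound: the positive part is at most \<open>\<bar>Z 1\<bar>\<close>, which up to
  polynomially small errors is of order \<open>sqrt (ln T) * d powr H\<close>. On the mesh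
  \<open>d = const * ln T powr (- 1 / (2 * H))\<close> the path moves by less than \<open>a\<close> between neighbouring
  mesh points, with the same kind of error, which passes from the mesh to continuous time.\<close>

subsection \<open>Finite families of random variables and their linear combinations\<close>

text \<open>Expected positive parts are known only to be nonincreasing, and expected maxima only up
  to constants. The upper estimate therefore averages over \<open>1, ..., n\<close>, and the lower
  one compares the expected maxima at \<open>n\<close> and \<open>K * n\<close> for a large fixed
  \<open>K\<close>. Gaussian laws enter through expected cosines of linear combinations, which see
  only the variance: equality of joint laws, symmetry and independence of residuals all follow from
  this. Tails enter through moments of order \<open>2 * q\<close>, with \<open>q\<close> fixed for
  the expected maximum and \<open>q\<close> of order \<open>ln T\<close> where an error has to beat
  a power of \<open>T\<close>.

  In the lower bound, with \<open>n\<close> of order \<open>T / d\<close>, the expected positive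
  part is of order \<open>d * T powr (- (1 - H))\<close>, and it has to be divided by the cutoff, of
  order \<open>sqrt q * d powr H\<close>. The width at which the path stays within \<open>a\<close>
  between mesh points is the one that makes this cutoff a constant, so the probability inherits the
  factor \<open>d\<close>. The upper bound uses the fixed mesh width 1 and loses no
  logarithm.\<close>

lemma iexp_eq_Complex: "iexp x = Complex (cos x) (sin x)"
  by (simp add: complex_eq_iff Re_exp Im_exp)

text \<open>Sine is written as a cosine with phase \<open>- pi / 2\<close>, so that both parts
  belong to the one family of phase-shifted cosines in which the hypotheses on laws are
  phrased.\<close>

lemma char_distr_density:
  fixes X w :: "'a \<Rightarrow> real"
  assumes [measurable]: "X \<in> borel_measurable M" and w: "integrable M w" "\<And>\<omega>. 0 \<le> w \<omega>"
  shows "char (distr (density M w) borel X) t =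
    Complex (\<integral>\<omega>. w \<omega> * cos (t * X \<omega>) \<partial>M) (\<integral>\<omega>. w \<omega> * cos (t * X \<omega> - pi / 2) \<partial>M)"
proof -
  have [measurable]: "w \<in> borel_measurable M"
    using w by simp
  have int: "integrable M (\<lambda>\<omega>. w \<omega> *\<^sub>R iexp (t * X \<omega>))"
    by (rule Bochner_Integration.integrable_bound[OF w(1)])
       (auto simp: norm_mult simp flip: of_real_mult)
  have "char (distr (density M w) borel X) t = (\<integral>\<omega>. w \<omega> *\<^sub>R iexp (t * X \<omega>) \<partial>M)"
    unfolding char_def
    by (subst integral_distr, simp, measurable, subst integral_density) (auto simp: w)
  also have "\<dots> = Complex (\<integral>\<omega>. Re (w \<omega> *\<^sub>R iexp (t * X \<omega>)) \<partial>M) (\<integral>\<omega>. Im (w \<omega> *\<^sub>R iexp (t * X \<omega>)) \<partial>M)"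
    using integral_Re[OF int] integral_Im[OF int] by (simp only: complex_eq_iff) simp
  also have "\<dots> = Complex (\<integral>\<omega>. w \<omega> * cos (t * X \<omega>) \<partial>M) (\<integral>\<omega>. w \<omega> * cos (t * X \<omega> - pi / 2) \<partial>M)"
    by (simp add: iexp_eq_Complex cos_diff del: of_real_mult)
  finally show ?thesis .
qed

text \<open>The case \<open>\<theta> = 0\<close>, \<open>t = 0\<close> shows that the total masses
  agree, so both weights can be normalised to probability densities and Levy's uniqueness theorem
  applies. If the mass is zero, both weights vanish almost everywhere.\<close>

lemma weighted_law_unique:
  fixes X w :: "'a \<Rightarrow> real" and Y v :: "'b \<Rightarrow> real"
  assumes X [measurable]: "X \<in> borel_measurable M" and w: "integrable M w" "\<And>\<omega>. 0 \<le> w \<omega>"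
    and Y [measurable]: "Y \<in> borel_measurable N" and v: "integrable N v" "\<And>\<omega>. 0 \<le> v \<omega>"
    and eq: "\<And>\<theta> t. (\<integral>\<omega>. w \<omega> * cos (\<theta> + t * X \<omega>) \<partial>M) = (\<integral>\<omega>. v \<omega> * cos (\<theta> + t * Y \<omega>) \<partial>N)"
    and A [measurable]: "A \<in> sets borel"
  shows "(\<integral>\<omega>. w \<omega> * indicator A (X \<omega>) \<partial>M) = (\<integral>\<omega>. v \<omega> * indicator A (Y \<omega>) \<partial>N)"
proof -
  have [measurable]: "w \<in> borel_measurable M" "v \<in> borel_measurable N"
    using w v by auto
  define m where "m = (\<integral>\<omega>. w \<omega> \<partial>M)"
  have m: "m = (\<integral>\<omega>. v \<omega> \<partial>N)"
    using eq[of 0 0] by (simp add: m_def)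
  have "m \<ge> 0"
    unfolding m_def by (rule integral_nonneg_AE) (auto simp: w)
  show ?thesis
  proof (cases "m = 0")
    case True
    have "AE \<omega> in M. w \<omega> = 0"
      using integral_nonneg_eq_0_iff_AE[OF w(1)] w(2) True by (simp add: m_def)
    moreover have "AE \<omega> in N. v \<omega> = 0"
      using integral_nonneg_eq_0_iff_AE[OF v(1)] v(2) True m by simp
    ultimately have "(\<integral>\<omega>. w \<omega> * indicator A (X \<omega>) \<partial>M) = 0" "(\<integral>\<omega>. v \<omega> * indicator A (Y \<omega>) \<partial>N) = 0"
      by (auto intro!: integral_eq_zero_AE)
    then show ?thesis
      by simp
  next
    case False
    with \<open>m \<ge> 0\<close> have "m > 0"
      by simp
    define P where "P = distr (density M (\<lambda>\<omega>. w \<omega> / m)) borel X"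
    define Q where "Q = distr (density N (\<lambda>\<omega>. v \<omega> / m)) borel Y"
    have dist: "real_distribution (distr (density L (\<lambda>\<omega>. u \<omega> / m)) borel Z)"
      if [measurable]: "Z \<in> borel_measurable L" and u: "integrable L u" "\<And>\<omega>. 0 \<le> u \<omega>" "m = (\<integral>\<omega>. u \<omega> \<partial>L)"
      for L :: "'c measure" and u Z :: "'c \<Rightarrow> real"
    proof -
      have [measurable]: "u \<in> borel_measurable L"
        using u by simp
      have "emeasure (density L (\<lambda>\<omega>. u \<omega> / m)) (space L) = (\<integral>\<^sup>+\<omega>. ennreal (u \<omega> / m) \<partial>L)"
        by (simp add: emeasure_density)
      also have "\<dots> = ennreal (\<integral>\<omega>. u \<omega> / m \<partial>L)"
        using u \<open>m > 0\<close> by (intro nn_integral_eq_integral) auto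
      also have "\<dots> = 1"
        using u(3) \<open>m > 0\<close> by simp
      finally have "prob_space (density L (\<lambda>\<omega>. u \<omega> / m))"
        by (intro prob_spaceI) simp
      then show ?thesis
        by (intro prob_space.real_distribution_distr) auto
    qed
    have chr: "char P = char Q"
    proof
      fix t
      have "(\<integral>\<omega>. w \<omega> / m * cos (\<theta> + t * X \<omega>) \<partial>M) = (\<integral>\<omega>. v \<omega> / m * cos (\<theta> + t * Y \<omega>) \<partial>N)" for \<theta>
        using eq[of \<theta> t] by simp
      from this[of 0] this[of "- pi / 2"]
      show "char P t = char Q t"
        unfolding P_def Q_def using \<open>m > 0\<close> w v
        by (subst (1 2) char_distr_density) (auto simp: add.commute)
    qed
    have "P = Q"
      unfolding P_def Q_def
      by (rule Levy_uniqueness[OF dist dist chr[unfolded P_def Q_def]]) (use w v m m_def in auto)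
    have val: "(\<integral>\<omega>. u \<omega> * indicator A (Z \<omega>) \<partial>L) =
        m * measure (distr (density L (\<lambda>\<omega>. u \<omega> / m)) borel Z) A"
      if [measurable]: "Z \<in> borel_measurable L" and u: "integrable L u" "\<And>\<omega>. 0 \<le> u \<omega>"
      for L :: "'c measure" and u Z :: "'c \<Rightarrow> real"
    proof -
      have [measurable]: "u \<in> borel_measurable L"
        using u by simp
      have "(\<integral>x. indicator A x \<partial>distr (density L (\<lambda>\<omega>. u \<omega> / m)) borel Z) =
        (\<integral>\<omega>. u \<omega> / m * indicator A (Z \<omega>) \<partial>L)"
        using u \<open>m > 0\<close>
        by (subst integral_distr, simp, measurable, subst integral_density) auto
      then show ?thesis
        using \<open>m > 0\<close> by simp
    qed
    show ?thesis
      using val[OF X w] val[OF Y v] \<open>P = Q\<close> by (simp add: P_def Q_def)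
  qed
qed

lemma integrable_mult_bounded:
  fixes f g :: "'a \<Rightarrow> real"
  assumes "integrable M f" "g \<in> borel_measurable M" "\<And>\<omega>. \<bar>g \<omega>\<bar> \<le> 1"
  shows "integrable M (\<lambda>\<omega>. f \<omega> * g \<omega>)"
proof (rule Bochner_Integration.integrable_bound[OF assms(1)])
  show "AE \<omega> in M. norm (f \<omega> * g \<omega>) \<le> norm (f \<omega>)"
    using assms(3) by (auto simp: abs_mult mult_left_le)
qed (use assms in auto)

text \<open>Coordinates are moved one at a time from the cosine into the product of indicators; the
  weight stays nonnegative because \<open>1 + cos \<ge> 0\<close>.\<close>

lemma rectangle_cos_unique:
  fixes X :: "'i \<Rightarrow> 'a \<Rightarrow> real" and Y :: "'i \<Rightarrow> 'b \<Rightarrow> real"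
  assumes "prob_space M" "prob_space N" and "finite J"
    and "finite I" "I \<inter> J = {}"
    and X: "\<And>i. i \<in> I \<union> J \<Longrightarrow> X i \<in> borel_measurable M"
    and Y: "\<And>i. i \<in> I \<union> J \<Longrightarrow> Y i \<in> borel_measurable N"
    and A: "\<And>i. i \<in> J \<Longrightarrow> A i \<in> sets borel"
    and eq: "\<And>\<theta> c. (\<integral>\<omega>. cos (\<theta> + (\<Sum>i\<in>I \<union> J. c i * X i \<omega>)) \<partial>M) =
      (\<integral>\<omega>. cos (\<theta> + (\<Sum>i\<in>I \<union> J. c i * Y i \<omega>)) \<partial>N)"
  shows "(\<integral>\<omega>. (\<Prod>j\<in>J. indicator (A j) (X j \<omega>)) * cos (\<theta> + (\<Sum>i\<in>I. c i * X i \<omega>)) \<partial>M) =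
    (\<integral>\<omega>. (\<Prod>j\<in>J. indicator (A j) (Y j \<omega>)) * cos (\<theta> + (\<Sum>i\<in>I. c i * Y i \<omega>)) \<partial>N)"
  using assms(3-)
proof (induction J arbitrary: I \<theta> c rule: finite_induct)
  case empty
  then show ?case
    by simp
next
  case (insert k J)
  interpret M: prob_space M by fact
  interpret N: prob_space N by fact
  have k: "k \<notin> I" "finite I"
    using insert.prems by auto
  have meas [measurable]: "\<And>i. i \<in> I \<union> J \<Longrightarrow> X i \<in> borel_measurable M" "X k \<in> borel_measurable M"
    "\<And>i. i \<in> I \<union> J \<Longrightarrow> Y i \<in> borel_measurable N" "Y k \<in> borel_measurable N"
    "\<And>j. j \<in> J \<Longrightarrow> A j \<in> sets borel" "A k \<in> sets borel"
    using insert.prems by auto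
  define p where "p \<omega> = (\<Prod>j\<in>J. indicator (A j) (X j \<omega>) :: real)" for \<omega>
  define r where "r \<omega> = (\<Prod>j\<in>J. indicator (A j) (Y j \<omega>) :: real)" for \<omega>
  define S where "S \<omega> = (\<Sum>i\<in>I. c i * X i \<omega>)" for \<omega>
  define R where "R \<omega> = (\<Sum>i\<in>I. c i * Y i \<omega>)" for \<omega>
  have bd: "0 \<le> p \<omega>" "p \<omega> \<le> 1" "0 \<le> r \<omega>'" "r \<omega>' \<le> 1" for \<omega> \<omega>'
    by (auto simp: p_def r_def intro!: prod_nonneg prod_le_1 indicator_le_1)
  have [measurable]: "p \<in> borel_measurable M" "r \<in> borel_measurable N"
    "S \<in> borel_measurable M" "R \<in> borel_measurable N"
    unfolding p_def[abs_def] r_def[abs_def] S_def[abs_def] R_def[abs_def] by measurable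
  have ip: "integrable M p" "integrable N r"
    using bd by (auto intro!: M.integrable_const_bound[of _ 1] N.integrable_const_bound[of _ 1])
  \<comment> \<open>The induction hypothesis is used with \<open>k\<close> still inside the cosine.
    The separate multipliers \<open>s\<close> and \<open>t\<close> allow dropping the old sum and
    changing the sign of the new coordinate.\<close>
  have IH: "(\<integral>\<omega>. p \<omega> * cos (\<theta> + (s * S \<omega> + t * X k \<omega>)) \<partial>M) =
      (\<integral>\<omega>. r \<omega> * cos (\<theta> + (s * R \<omega> + t * Y k \<omega>)) \<partial>N)" for \<theta> s t
  proof -
    define d where "d i = (if i = k then t else s * c i)" for i
    have "(\<Sum>i\<in>insert k I. d i * X i \<omega>) = s * S \<omega> + t * X k \<omega>" for \<omega>
      using k by (auto simp: d_def S_def sum_distrib_left mult.assoc intro!: sum.cong)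
    moreover have "(\<Sum>i\<in>insert k I. d i * Y i \<omega>) = s * R \<omega> + t * Y k \<omega>" for \<omega>
      using k by (auto simp: d_def R_def sum_distrib_left mult.assoc intro!: sum.cong)
    moreover have "(\<integral>\<omega>. p \<omega> * cos (\<theta> + (\<Sum>i\<in>insert k I. d i * X i \<omega>)) \<partial>M) =
      (\<integral>\<omega>. r \<omega> * cos (\<theta> + (\<Sum>i\<in>insert k I. d i * Y i \<omega>)) \<partial>N)"
      unfolding p_def r_def
    proof (rule insert.IH)
      show "(\<integral>\<omega>. cos (\<theta> + (\<Sum>i\<in>insert k I \<union> J. c i * X i \<omega>)) \<partial>M) =
        (\<integral>\<omega>. cos (\<theta> + (\<Sum>i\<in>insert k I \<union> J. c i * Y i \<omega>)) \<partial>N)" for \<theta> c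
        using insert.prems(6)[of \<theta> c] by simp
    qed (use insert.prems insert.hyps in auto)
    ultimately show ?thesis
      by simp
  qed
  have "(\<integral>\<omega>. p \<omega> * (1 + cos (\<theta> + S \<omega>)) * cos (\<theta>' + t * X k \<omega>) \<partial>M) =
      (\<integral>\<omega>. r \<omega> * (1 + cos (\<theta> + R \<omega>)) * cos (\<theta>' + t * Y k \<omega>) \<partial>N)" for \<theta>' t
  proof -
    \<comment> \<open>The product of two cosines becomes a sum of cosines, so the weighted integral
      splits into three instances of \<open>IH\<close>, with \<open>(s, t)\<close> replaced by
      \<open>(0, t)\<close>, \<open>(1, - t)\<close> and \<open>(1, t)\<close>.\<close>
    have split: "P * (1 + cos (\<theta> + T)) * cos (\<theta>' + t * x) =
      P * cos (\<theta>' + (0 * T + t * x)) + P * cos ((\<theta> - \<theta>') + (1 * T + (-t) * x)) / 2 +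
      P * cos ((\<theta> + \<theta>') + (1 * T + t * x)) / 2" for P T x
    proof -
      have "cos (\<theta> + T) * cos (\<theta>' + t * x) =
        (cos ((\<theta> + T) - (\<theta>' + t * x)) + cos ((\<theta> + T) + (\<theta>' + t * x))) / 2"
        by (rule cos_times_cos)
      also have "\<dots> = (cos ((\<theta> - \<theta>') + (1 * T + (-t) * x)) + cos ((\<theta> + \<theta>') + (1 * T + t * x))) / 2"
        by (simp add: algebra_simps)
      finally have "P * (1 + cos (\<theta> + T)) * cos (\<theta>' + t * x) = P * cos (\<theta>' + t * x) +
        P * ((cos ((\<theta> - \<theta>') + (1 * T + (-t) * x)) + cos ((\<theta> + \<theta>') + (1 * T + t * x))) / 2)"
        by (metis distrib_left distrib_right mult.assoc mult.left_neutral mult.right_neutral)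
      then show ?thesis
        by (simp only: add_divide_distrib distrib_left times_divide_eq_right mult_zero_left add_0_left add.assoc)
    qed
    have i1: "integrable M (\<lambda>\<omega>. p \<omega> * cos (a + (s * S \<omega> + t * X k \<omega>)))" for a s t
      by (rule integrable_mult_bounded[OF ip(1)]) auto
    have i2: "integrable N (\<lambda>\<omega>. r \<omega> * cos (a + (s * R \<omega> + t * Y k \<omega>)))" for a s t
      by (rule integrable_mult_bounded[OF ip(2)]) auto
    show ?thesis
      unfolding split
      by (simp only: Bochner_Integration.integral_add integral_divide_zero i1 i2 IH
          Bochner_Integration.integrable_add Bochner_Integration.integrable_divide_zero)
  qed
  then have 1: "(\<integral>\<omega>. p \<omega> * (1 + cos (\<theta> + S \<omega>)) * indicator (A k) (X k \<omega>) \<partial>M) =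
      (\<integral>\<omega>. r \<omega> * (1 + cos (\<theta> + R \<omega>)) * indicator (A k) (Y k \<omega>) \<partial>N)"
  proof (rule weighted_law_unique[rotated 6])
    have "0 \<le> 1 + cos x" for x :: real
      using cos_ge_minus_one[of x] by linarith
    then show "0 \<le> p \<omega> * (1 + cos (\<theta> + S \<omega>))" "0 \<le> r \<omega>' * (1 + cos (\<theta> + R \<omega>'))" for \<omega> \<omega>'
      using bd by auto
    show "integrable M (\<lambda>\<omega>. p \<omega> * (1 + cos (\<theta> + S \<omega>)))" "integrable N (\<lambda>\<omega>. r \<omega> * (1 + cos (\<theta> + R \<omega>)))"
      by (auto simp: distrib_left ip intro!: integrable_mult_bounded Bochner_Integration.integrable_add)
  qed auto
  have 2: "(\<integral>\<omega>. p \<omega> * indicator (A k) (X k \<omega>) \<partial>M) = (\<integral>\<omega>. r \<omega> * indicator (A k) (Y k \<omega>) \<partial>N)"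
    by (rule weighted_law_unique) (use ip bd IH[of _ 0] in auto)
  have j1: "integrable M (\<lambda>\<omega>. p \<omega> * indicator (A k) (X k \<omega>))"
    by (rule integrable_mult_bounded[OF ip(1)]) (auto simp: indicator_def)
  have j2: "integrable N (\<lambda>\<omega>. r \<omega> * indicator (A k) (Y k \<omega>))"
    by (rule integrable_mult_bounded[OF ip(2)]) (auto simp: indicator_def)
  have j3: "integrable M (\<lambda>\<omega>. p \<omega> * indicator (A k) (X k \<omega>) * cos (\<theta> + S \<omega>))"
    by (rule integrable_mult_bounded[OF j1]) auto
  have j4: "integrable N (\<lambda>\<omega>. r \<omega> * indicator (A k) (Y k \<omega>) * cos (\<theta> + R \<omega>))"
    by (rule integrable_mult_bounded[OF j2]) auto
  \<comment> \<open>The 1 served only to keep the weight nonnegative; subtracting fact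
    \<open>2\<close> from fact \<open>1\<close> removes it again.\<close>
  have e: "P * (1 + C) * I = P * I + P * I * C" for P C I :: real
    by (simp add: algebra_simps)
  have "(\<integral>\<omega>. p \<omega> * indicator (A k) (X k \<omega>) * cos (\<theta> + S \<omega>) \<partial>M) =
    (\<integral>\<omega>. r \<omega> * indicator (A k) (Y k \<omega>) * cos (\<theta> + R \<omega>) \<partial>N)"
    using 1 2 j1 j2 j3 j4 unfolding e by simp
  then show ?case
    using insert.hyps by (simp add: p_def r_def S_def R_def mult.commute mult.left_commute)
qed

text \<open>Boxes are an intersection-stable generator of the product algebra, and the probability
  of a box is the expected product of indicators: the case of \<open>rectangle_cos_unique\<close> in
  which no coordinate is left in the cosine.\<close>

lemma distr_PiM_unique:
  fixes X :: "'i \<Rightarrow> 'a \<Rightarrow> real" and Y :: "'i \<Rightarrow> 'b \<Rightarrow> real"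
  assumes M: "prob_space M" and N: "prob_space N" and I: "finite I"
    and X: "\<And>i. i \<in> I \<Longrightarrow> X i \<in> borel_measurable M"
    and Y: "\<And>i. i \<in> I \<Longrightarrow> Y i \<in> borel_measurable N"
    and eq: "\<And>\<theta> c. (\<integral>\<omega>. cos (\<theta> + (\<Sum>i\<in>I. c i * X i \<omega>)) \<partial>M) =
      (\<integral>\<omega>. cos (\<theta> + (\<Sum>i\<in>I. c i * Y i \<omega>)) \<partial>N)"
  shows "distr M (Pi\<^sub>M I (\<lambda>_. borel)) (\<lambda>\<omega>. \<lambda>i\<in>I. X i \<omega>) =
    distr N (Pi\<^sub>M I (\<lambda>_. borel)) (\<lambda>\<omega>. \<lambda>i\<in>I. Y i \<omega>)"
proof (rule measure_eqI_PiM_finite[OF I])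
  interpret M: prob_space M by fact
  interpret N: prob_space N by fact
  have mX: "(\<lambda>\<omega>. \<lambda>i\<in>I. X i \<omega>) \<in> measurable M (Pi\<^sub>M I (\<lambda>_. borel))"
    using X by (intro measurable_restrict) auto
  have mY: "(\<lambda>\<omega>. \<lambda>i\<in>I. Y i \<omega>) \<in> measurable N (Pi\<^sub>M I (\<lambda>_. borel))"
    using Y by (intro measurable_restrict) auto
  show "emeasure (distr M (Pi\<^sub>M I (\<lambda>_. borel)) (\<lambda>\<omega>. \<lambda>i\<in>I. X i \<omega>)) (Pi\<^sub>E I A) =
    emeasure (distr N (Pi\<^sub>M I (\<lambda>_. borel)) (\<lambda>\<omega>. \<lambda>i\<in>I. Y i \<omega>)) (Pi\<^sub>E I A)"
    if A: "\<And>i. i \<in> I \<Longrightarrow> A i \<in> sets borel" for A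
  proof -
    have sets: "Pi\<^sub>E I A \<in> sets (Pi\<^sub>M I (\<lambda>_. borel))"
      using A I by (intro sets_PiM_I_finite) auto
    have val: "emeasure (distr L (Pi\<^sub>M I (\<lambda>_. borel)) (\<lambda>\<omega>. \<lambda>i\<in>I. Z i \<omega>)) (Pi\<^sub>E I A) =
        ennreal (\<integral>\<omega>. (\<Prod>j\<in>I. indicator (A j) (Z j \<omega>)) \<partial>L)"
      if L: "prob_space L" and Z: "(\<lambda>\<omega>. \<lambda>i\<in>I. Z i \<omega>) \<in> measurable L (Pi\<^sub>M I (\<lambda>_. borel))"
      for L :: "'c measure" and Z
    proof -
      interpret L: prob_space L by fact
      have m: "((\<lambda>\<omega>. \<lambda>i\<in>I. Z i \<omega>) -` Pi\<^sub>E I A) \<inter> space L \<in> sets L"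
        by (rule measurable_sets[OF Z sets])
      have "emeasure (distr L (Pi\<^sub>M I (\<lambda>_. borel)) (\<lambda>\<omega>. \<lambda>i\<in>I. Z i \<omega>)) (Pi\<^sub>E I A) =
          ennreal (measure L ((\<lambda>\<omega>. \<lambda>i\<in>I. Z i \<omega>) -` Pi\<^sub>E I A \<inter> space L))"
        by (subst emeasure_distr[OF Z sets]) (simp add: L.emeasure_eq_measure)
      also have "measure L ((\<lambda>\<omega>. \<lambda>i\<in>I. Z i \<omega>) -` Pi\<^sub>E I A \<inter> space L) =
          (\<integral>\<omega>. indicator ((\<lambda>\<omega>. \<lambda>i\<in>I. Z i \<omega>) -` Pi\<^sub>E I A \<inter> space L) \<omega> \<partial>L)"
        using m by simp
      also have "\<dots> = (\<integral>\<omega>. (\<Prod>j\<in>I. indicator (A j) (Z j \<omega>)) \<partial>L)"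
      proof (rule Bochner_Integration.integral_cong[OF refl])
        fix \<omega> assume "\<omega> \<in> space L"
        then show "indicator ((\<lambda>\<omega>. \<lambda>i\<in>I. Z i \<omega>) -` Pi\<^sub>E I A \<inter> space L) \<omega> =
            (\<Prod>j\<in>I. indicator (A j) (Z j \<omega>) :: real)"
          using I by (cases "\<forall>j\<in>I. Z j \<omega> \<in> A j") (auto simp: indicator_def PiE_iff prod_zero_iff)
      qed
      finally show ?thesis .
    qed
    show ?thesis
      using rectangle_cos_unique[OF M N I, of "{}" X Y A 0] assms A val[OF M mX] val[OF N mY]
      by simp
  qed
  define C :: "nat \<Rightarrow> ('i \<Rightarrow> real) set" where "C n = (\<Pi>\<^sub>E i\<in>I. UNIV)" for n
  show "range C \<subseteq> prod_algebra I (\<lambda>_. borel)"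
    unfolding C_def using I by (auto intro!: prod_algebraI_finite)
  show "(\<Union>n. C n) = space (Pi\<^sub>M I (\<lambda>_. borel))"
    by (auto simp: C_def space_PiM)
  show "emeasure (distr M (Pi\<^sub>M I (\<lambda>_. borel)) (\<lambda>\<omega>. \<lambda>i\<in>I. X i \<omega>)) (C n) \<noteq> \<infinity>" for n
    using mX by (simp add: M.emeasure_eq_measure emeasure_distr C_def sets_PiM_I_finite I)
qed auto

subsection \<open>Centred Gaussian spaces\<close>

lemma (in prob_space) centred_gaussian_cases:
  assumes "gaussian_rv X" "expectation X = 0"
  obtains (degenerate) "AE \<omega> in M. X \<omega> = 0"
    | (normal) \<sigma> where "\<sigma> > 0" "distributed M lborel X (normal_density 0 \<sigma>)"
proof -
  have [measurable]: "random_variable borel X"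
    using assms by (simp add: gaussian_rv_def)
  consider \<mu> where "AE \<omega> in M. X \<omega> = \<mu>"
    | \<mu> \<sigma> where "\<sigma> > 0" "distributed M lborel X (normal_density \<mu> \<sigma>)"
    using assms by (auto simp: gaussian_rv_def)
  then show ?thesis
  proof cases
    case (1 \<mu>)
    have "expectation X = expectation (\<lambda>_. \<mu>)"
      using 1 by (intro integral_cong_AE) auto
    then show ?thesis
      using 1 degenerate assms(2) by (simp add: prob_space)
  next
    case (2 \<mu> \<sigma>)
    then have "\<mu> = 0"
      using normal_distributed_expectation[of \<sigma> X \<mu>] assms(2) by simp
    with 2 normal show ?thesis
      by simp
  qed
qed

text \<open>The left-hand side is the moment of order \<open>2 * k\<close> of a standard normal
  variable. The quotient of \<open>fact (2 * k)\<close> by \<open>fact k\<close> has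
  \<open>k\<close> factors, each at most \<open>2 * k\<close>.\<close>

lemma fact_2k_le: "fact (2 * k) / (2 ^ k * fact k) \<le> real k ^ k"
proof -
  have "fact (2 * k) div fact (2 * k - k) \<le> (2 * k) ^ k"
    by (rule fact_div_fact_le_pow) simp
  moreover have "fact (2 * k) = fact (2 * k) div fact k * (fact k :: nat)"
    by (simp add: fact_dvd)
  ultimately have "fact (2 * k) \<le> (2 * k) ^ k * (fact k :: nat)"
    by (metis diff_add_inverse2 mult_2 mult_le_mono1)
  then have "real (fact (2 * k)) \<le> real ((2 * k) ^ k * fact k)"
    by (simp only: of_nat_le_iff)
  then show ?thesis
    by (simp add: field_simps power_mult_distrib)
qed

context prob_space
begin

context
  fixes X :: "'a \<Rightarrow> real"
  assumes X: "gaussian_rv X" "expectation X = 0"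
begin

lemma centred_gaussian_measurable: "random_variable borel X"
  using X by (simp add: gaussian_rv_def)

lemma centred_gaussian_integrable_power: "integrable M (\<lambda>\<omega>. X \<omega> ^ k)"
  using X
proof (cases rule: centred_gaussian_cases)
  case degenerate
  have "integrable M (\<lambda>\<omega>. X \<omega> ^ k) \<longleftrightarrow> integrable M (\<lambda>_. (0::real) ^ k)"
    using degenerate centred_gaussian_measurable by (intro integrable_cong_AE) auto
  then show ?thesis
    by simp
next
  case (normal \<sigma>)
  then show ?thesis
    using integrable_normal_moment[OF normal(1), of 0 k]
    by (subst (asm) distributed_integrable[OF normal(2)]) auto
qed

lemma centred_gaussian_variance_normal:
  assumes "\<sigma> > 0" "distributed M lborel X (normal_density 0 \<sigma>)"
  shows "expectation (\<lambda>\<omega>. X \<omega> ^ 2) = \<sigma>\<^sup>2"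
  using normal_distributed_variance[OF assms] X by simp

lemma centred_gaussian_even_moment:
  assumes "k > 0"
  shows "expectation (\<lambda>\<omega>. X \<omega> ^ (2 * k)) \<le> (real k * expectation (\<lambda>\<omega>. X \<omega> ^ 2)) ^ k"
  using X
proof (cases rule: centred_gaussian_cases)
  case degenerate
  have "expectation (\<lambda>\<omega>. X \<omega> ^ (2 * k)) = 0"
    using degenerate assms by (intro integral_eq_zero_AE) auto
  then show ?thesis
    by simp
next
  case (normal \<sigma>)
  have "expectation (\<lambda>\<omega>. X \<omega> ^ (2 * k)) = fact (2 * k) / ((2 / \<sigma>\<^sup>2) ^ k * fact k)"
    using integral_normal_moment_even[OF normal(1), of 0 k]
    by (subst (asm) distributed_integral[OF normal(2)]) auto
  also have "\<dots> = fact (2 * k) / (2 ^ k * fact k) * (\<sigma>\<^sup>2) ^ k"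
    using normal(1) by (simp add: power_divide)
  also have "\<dots> \<le> real k ^ k * (\<sigma>\<^sup>2) ^ k"
    by (intro mult_right_mono fact_2k_le) simp
  finally show ?thesis
    using centred_gaussian_variance_normal[OF normal] by (simp add: power_mult_distrib)
qed

lemma centred_gaussian_abs_moment:
  "expectation (\<lambda>\<omega>. \<bar>X \<omega>\<bar>) = sqrt (2 / pi) * sqrt (expectation (\<lambda>\<omega>. X \<omega> ^ 2))"
  using X
proof (cases rule: centred_gaussian_cases)
  case degenerate
  have "expectation (\<lambda>\<omega>. \<bar>X \<omega>\<bar>) = 0" "expectation (\<lambda>\<omega>. X \<omega> ^ 2) = 0"
    using degenerate by (auto intro!: integral_eq_zero_AE)
  then show ?thesis
    by simp
next
  case (normal \<sigma>)
  have "expectation (\<lambda>\<omega>. \<bar>X \<omega>\<bar>) = \<sigma> * sqrt (2 / pi)"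
    using integral_normal_moment_abs_odd[OF normal(1), of 0 0]
    by (subst (asm) distributed_integral[OF normal(2)]) auto
  then show ?thesis
    using centred_gaussian_variance_normal[OF normal] normal(1) by simp
qed

lemma centred_gaussian_expectation_cos:
  "expectation (\<lambda>\<omega>. cos (\<theta> + X \<omega>)) = cos \<theta> * exp (- expectation (\<lambda>\<omega>. X \<omega> ^ 2) / 2)"
  using X
proof (cases rule: centred_gaussian_cases)
  case degenerate
  have "expectation (\<lambda>\<omega>. X \<omega> ^ 2) = 0"
    using degenerate by (auto intro!: integral_eq_zero_AE)
  moreover have "expectation (\<lambda>\<omega>. cos (\<theta> + X \<omega>)) = expectation (\<lambda>_. cos \<theta>)"
    using degenerate centred_gaussian_measurable by (intro integral_cong_AE) auto
  ultimately show ?thesis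
    by (simp add: prob_space)
next
  case (normal \<sigma>)
  have [measurable]: "random_variable borel X"
    by (rule centred_gaussian_measurable)
  have "distributed M lborel (\<lambda>\<omega>. X \<omega> / \<sigma>) std_normal_density"
    using normal_standard_normal_convert[OF normal(1), of X 0] normal(2) by simp
  then have D: "distr M lborel (\<lambda>\<omega>. X \<omega> / \<sigma>) = std_normal_distribution"
    by (simp add: distributed_def)
  have "integrable M (\<lambda>\<omega>. iexp (X \<omega>))"
    by (rule integrable_iexp) auto
  then have int: "integrable M (\<lambda>\<omega>. iexp \<theta> * iexp (X \<omega>))"
    by simp
  have "char (distr M lborel (\<lambda>\<omega>. X \<omega> / \<sigma>)) \<sigma> = expectation (\<lambda>\<omega>. iexp (X \<omega>))"
    unfolding char_def using normal(1) by (subst integral_distr) auto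
  then have "expectation (\<lambda>\<omega>. iexp (X \<omega>)) = complex_of_real (exp (- (\<sigma>\<^sup>2) / 2))"
    using char_std_normal_distribution by (simp add: D)
  then have "expectation (\<lambda>\<omega>. iexp \<theta> * iexp (X \<omega>)) = iexp \<theta> * complex_of_real (exp (- (\<sigma>\<^sup>2) / 2))"
    by simp
  then have "Re (expectation (\<lambda>\<omega>. iexp \<theta> * iexp (X \<omega>))) = cos \<theta> * exp (- (\<sigma>\<^sup>2) / 2)"
    by (simp add: Re_exp)
  moreover have "Re (expectation (\<lambda>\<omega>. iexp \<theta> * iexp (X \<omega>))) = expectation (\<lambda>\<omega>. cos (\<theta> + X \<omega>))"
    by (subst integral_Re[OF int, symmetric]) (simp add: iexp_eq_Complex cos_add)
  ultimately show ?thesis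
    using centred_gaussian_variance_normal[OF normal] by simp
qed

text \<open>A normal density is positive everywhere, so a half-line of probability zero would make
  the interval from \<open>u\<close> to \<open>u + 1\<close> a Lebesgue null set.\<close>

lemma centred_gaussian_prob_atLeast_pos:
  assumes "expectation (\<lambda>\<omega>. X \<omega> ^ 2) > 0"
  shows "prob {\<omega> \<in> space M. u \<le> X \<omega>} > 0"
  using X
proof (cases rule: centred_gaussian_cases)
  case degenerate
  have "expectation (\<lambda>\<omega>. X \<omega> ^ 2) = 0"
    using degenerate by (auto intro!: integral_eq_zero_AE)
  with assms show ?thesis
    by simp
next
  case (normal \<sigma>)
  have [measurable]: "random_variable borel X"
    by (rule centred_gaussian_measurable)
  have "emeasure M (X -` {u..} \<inter> space M) = (\<integral>\<^sup>+x\<in>{u..}. normal_density 0 \<sigma> x \<partial>lborel)"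
    by (rule distributed_emeasure[OF normal(2)]) simp
  moreover have "(\<integral>\<^sup>+x\<in>{u..}. normal_density 0 \<sigma> x \<partial>lborel) \<noteq> 0"
  proof
    assume "(\<integral>\<^sup>+x\<in>{u..}. normal_density 0 \<sigma> x \<partial>lborel) = 0"
    then have "AE x in lborel. ennreal (normal_density 0 \<sigma> x) * indicator {u..} x = 0"
      by (subst (asm) nn_integral_0_iff_AE) auto
    then have "AE x in lborel. x \<notin> {u..u+1}"
      by eventually_elim (use normal_density_pos[OF normal(1)] in \<open>auto simp: indicator_def not_less split: if_splits\<close>, smt (verit))
    then have "emeasure lborel {u..u+1} = 0"
      by (subst (asm) AE_iff_measurable[of "{u..u+1}"]) auto
    then show False
      by simp
  qed
  moreover have "X -` {u..} \<inter> space M = {\<omega> \<in> space M. u \<le> X \<omega>}"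
    by auto
  ultimately show ?thesis
    by (metis emeasure_eq_measure ennreal_0 zero_less_measure_iff)
qed

end

end

text \<open>Closure under linear combinations encodes joint Gaussianity. Working with a linear set
  instead of an indexed family lets increments, reflections and regression residuals be treated
  alike.\<close>

locale centred_gaussian_space = prob_space M for M :: "'a measure" +
  fixes L :: "('a \<Rightarrow> real) set"
  assumes gaussian: "X \<in> L \<Longrightarrow> gaussian_rv X"
    and centred: "X \<in> L \<Longrightarrow> expectation X = 0"
    and zero: "(\<lambda>_. 0) \<in> L"
    and add: "X \<in> L \<Longrightarrow> Y \<in> L \<Longrightarrow> (\<lambda>\<omega>. X \<omega> + Y \<omega>) \<in> L"
    and scale: "X \<in> L \<Longrightarrow> (\<lambda>\<omega>. c * X \<omega>) \<in> L"
begin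

lemma
  assumes "X \<in> L"
  shows measurable [measurable]: "X \<in> borel_measurable M"
    and integrable_power: "integrable M (\<lambda>\<omega>. X \<omega> ^ k)"
    and even_moment: "k > 0 \<Longrightarrow>
      expectation (\<lambda>\<omega>. X \<omega> ^ (2 * k)) \<le> (real k * expectation (\<lambda>\<omega>. X \<omega> ^ 2)) ^ k"
    and abs_moment: "expectation (\<lambda>\<omega>. \<bar>X \<omega>\<bar>) = sqrt (2 / pi) * sqrt (expectation (\<lambda>\<omega>. X \<omega> ^ 2))"
    and expectation_cos: "expectation (\<lambda>\<omega>. cos (\<theta> + X \<omega>)) =
      cos \<theta> * exp (- expectation (\<lambda>\<omega>. X \<omega> ^ 2) / 2)"
    and prob_atLeast_pos: "expectation (\<lambda>\<omega>. X \<omega> ^ 2) > 0 \<Longrightarrow> prob {\<omega> \<in> space M. u \<le> X \<omega>} > 0"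
proof -
  note X = gaussian[OF assms] centred[OF assms]
  note facts = centred_gaussian_measurable[OF X] centred_gaussian_integrable_power[OF X]
    centred_gaussian_even_moment[OF X] centred_gaussian_abs_moment[OF X]
    centred_gaussian_expectation_cos[OF X] centred_gaussian_prob_atLeast_pos[OF X]
  show "X \<in> borel_measurable M" "integrable M (\<lambda>\<omega>. X \<omega> ^ k)"
    "k > 0 \<Longrightarrow> expectation (\<lambda>\<omega>. X \<omega> ^ (2 * k)) \<le> (real k * expectation (\<lambda>\<omega>. X \<omega> ^ 2)) ^ k"
    "expectation (\<lambda>\<omega>. \<bar>X \<omega>\<bar>) = sqrt (2 / pi) * sqrt (expectation (\<lambda>\<omega>. X \<omega> ^ 2))"
    "expectation (\<lambda>\<omega>. cos (\<theta> + X \<omega>)) = cos \<theta> * exp (- expectation (\<lambda>\<omega>. X \<omega> ^ 2) / 2)"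
    "expectation (\<lambda>\<omega>. X \<omega> ^ 2) > 0 \<Longrightarrow> prob {\<omega> \<in> space M. u \<le> X \<omega>} > 0"
    by (fact facts)+
qed

lemma integrable: "X \<in> L \<Longrightarrow> integrable M X"
  using integrable_power[of X 1] by simp

lemma diff: "X \<in> L \<Longrightarrow> Y \<in> L \<Longrightarrow> (\<lambda>\<omega>. X \<omega> - Y \<omega>) \<in> L"
  using add[of X "\<lambda>\<omega>. (-1) * Y \<omega>"] scale[of Y "-1"] by simp

lemma minus: "X \<in> L \<Longrightarrow> (\<lambda>\<omega>. - X \<omega>) \<in> L"
  using scale[of X "-1"] by simp

lemma sum: "(\<And>i. i \<in> I \<Longrightarrow> X i \<in> L) \<Longrightarrow> (\<lambda>\<omega>. \<Sum>i\<in>I. c i * X i \<omega>) \<in> L"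
proof (induction I rule: infinite_finite_induct)
  case (insert i I)
  then show ?case
    using add[of "\<lambda>\<omega>. c i * X i \<omega>" "\<lambda>\<omega>. \<Sum>i\<in>I. c i * X i \<omega>"] scale[of "X i" "c i"] by simp
qed (auto simp: zero)

lemma integrable_mult:
  assumes [simp, intro]: "X \<in> L" "Y \<in> L" shows "integrable M (\<lambda>\<omega>. X \<omega> * Y \<omega>)"
proof -
  have "integrable M (\<lambda>\<omega>. ((X \<omega> + Y \<omega>)\<^sup>2 - (X \<omega>)\<^sup>2 - (Y \<omega>)\<^sup>2) / 2)"
    by (intro Bochner_Integration.integrable_diff integrable_divide_zero integrable_power add assms)
  moreover have "((X \<omega> + Y \<omega>)\<^sup>2 - (X \<omega>)\<^sup>2 - (Y \<omega>)\<^sup>2) / 2 = X \<omega> * Y \<omega>" for \<omega>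
    by (simp add: power2_sum)
  ultimately show ?thesis
    by simp
qed

lemma variance_sum:
  assumes "\<And>i. i \<in> I \<Longrightarrow> X i \<in> L"
  shows "expectation (\<lambda>\<omega>. (\<Sum>i\<in>I. c i * X i \<omega>)\<^sup>2) =
    (\<Sum>i\<in>I. \<Sum>j\<in>I. c i * c j * expectation (\<lambda>\<omega>. X i \<omega> * X j \<omega>))"
proof -
  have "(\<Sum>i\<in>I. c i * X i \<omega>)\<^sup>2 = (\<Sum>i\<in>I. \<Sum>j\<in>I. c i * c j * (X i \<omega> * X j \<omega>))" for \<omega>
    by (simp add: power2_eq_square sum_product mult_ac)
  then show ?thesis
    using assms integrable_mult by (simp add: Bochner_Integration.integral_sum)
qed

end

text \<open>The expected cosine of a linear combination depends on its variance alone, hence on the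
  covariances. Stationarity of the increments, time reversal and symmetry are all applied through
  this lemma.\<close>

lemma gaussian_distr_PiM_eq:
  assumes M: "centred_gaussian_space M L" and N: "centred_gaussian_space N K"
    and I: "finite I" and X: "\<And>i. i \<in> I \<Longrightarrow> X i \<in> L" and Y: "\<And>i. i \<in> I \<Longrightarrow> Y i \<in> K"
    and cov: "\<And>i j. i \<in> I \<Longrightarrow> j \<in> I \<Longrightarrow>
      (\<integral>\<omega>. X i \<omega> * X j \<omega> \<partial>M) = (\<integral>\<omega>. Y i \<omega> * Y j \<omega> \<partial>N)"
  shows "distr M (Pi\<^sub>M I (\<lambda>_. borel)) (\<lambda>\<omega>. \<lambda>i\<in>I. X i \<omega>) =
    distr N (Pi\<^sub>M I (\<lambda>_. borel)) (\<lambda>\<omega>. \<lambda>i\<in>I. Y i \<omega>)"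
proof -
  interpret M: centred_gaussian_space M L by fact
  interpret N: centred_gaussian_space N K by fact
  show ?thesis
  proof (rule distr_PiM_unique)
    fix \<theta> and c :: "'c \<Rightarrow> real"
    have "M.expectation (\<lambda>\<omega>. (\<Sum>i\<in>I. c i * X i \<omega>)\<^sup>2) = N.expectation (\<lambda>\<omega>. (\<Sum>i\<in>I. c i * Y i \<omega>)\<^sup>2)"
      using M.variance_sum[of I X c] N.variance_sum[of I Y c] X Y cov by simp
    then show "M.expectation (\<lambda>\<omega>. cos (\<theta> + (\<Sum>i\<in>I. c i * X i \<omega>))) =
        N.expectation (\<lambda>\<omega>. cos (\<theta> + (\<Sum>i\<in>I. c i * Y i \<omega>)))"
      by (simp add: M.expectation_cos[OF M.sum] N.expectation_cos[OF N.sum] X Y)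
  qed (use M N I X Y in \<open>auto simp: M.prob_space_axioms N.prob_space_axioms\<close>)
qed

text \<open>The premises \<open>fX\<close> and \<open>fY\<close> absorb the restriction to
  \<open>I\<close>, so that the conclusion speaks of the original variables.\<close>

lemma expectation_eq_if_distr_PiM_eq:
  fixes f :: "('i \<Rightarrow> real) \<Rightarrow> real"
  assumes eq: "distr M (Pi\<^sub>M I (\<lambda>_. borel)) (\<lambda>\<omega>. \<lambda>i\<in>I. X i \<omega>) =
      distr N (Pi\<^sub>M I (\<lambda>_. borel)) (\<lambda>\<omega>. \<lambda>i\<in>I. Y i \<omega>)"
    and X: "\<And>i. i \<in> I \<Longrightarrow> X i \<in> borel_measurable M"
    and Y: "\<And>i. i \<in> I \<Longrightarrow> Y i \<in> borel_measurable N"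
    and f: "f \<in> borel_measurable (Pi\<^sub>M I (\<lambda>_. borel))"
    and fX: "\<And>\<omega>. f (\<lambda>i\<in>I. X i \<omega>) = F \<omega>" and fY: "\<And>\<omega>. f (\<lambda>i\<in>I. Y i \<omega>) = G \<omega>"
  shows "integral\<^sup>L M F = integral\<^sup>L N G"
proof -
  have "(\<integral>\<omega>. f (\<lambda>i\<in>I. X i \<omega>) \<partial>M) = (\<integral>\<omega>. f (\<lambda>i\<in>I. Y i \<omega>) \<partial>N)"
    using arg_cong[OF eq, of "\<lambda>D. integral\<^sup>L D f"] X Y f
    by (simp add: integral_distr)
  then show ?thesis
    by (simp add: fX fY)
qed

lemma prob_eq_if_distr_PiM_eq:
  fixes P :: "('i \<Rightarrow> real) \<Rightarrow> bool"
  assumes eq: "distr M (Pi\<^sub>M I (\<lambda>_. borel)) (\<lambda>\<omega>. \<lambda>i\<in>I. X i \<omega>) =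
      distr N (Pi\<^sub>M I (\<lambda>_. borel)) (\<lambda>\<omega>. \<lambda>i\<in>I. Y i \<omega>)"
    and X: "\<And>i. i \<in> I \<Longrightarrow> X i \<in> borel_measurable M"
    and Y: "\<And>i. i \<in> I \<Longrightarrow> Y i \<in> borel_measurable N"
    and P: "Measurable.pred (Pi\<^sub>M I (\<lambda>_. borel)) P"
    and PX: "\<And>\<omega>. P (\<lambda>i\<in>I. X i \<omega>) \<longleftrightarrow> Q \<omega>" and PY: "\<And>\<omega>. P (\<lambda>i\<in>I. Y i \<omega>) \<longleftrightarrow> R \<omega>"
  shows "measure M {\<omega> \<in> space M. Q \<omega>} = measure N {\<omega> \<in> space N. R \<omega>}"
proof -
  have mX: "(\<lambda>\<omega>. \<lambda>i\<in>I. X i \<omega>) \<in> measurable M (Pi\<^sub>M I (\<lambda>_. borel))"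
    using X by (intro measurable_restrict) auto
  have mY: "(\<lambda>\<omega>. \<lambda>i\<in>I. Y i \<omega>) \<in> measurable N (Pi\<^sub>M I (\<lambda>_. borel))"
    using Y by (intro measurable_restrict) auto
  define E where "E = {x \<in> space (Pi\<^sub>M I (\<lambda>_. borel :: real measure)). P x}"
  have E: "E \<in> sets (Pi\<^sub>M I (\<lambda>_. borel))"
    unfolding E_def using P by simp
  have "measure M ((\<lambda>\<omega>. \<lambda>i\<in>I. X i \<omega>) -` E \<inter> space M) = measure N ((\<lambda>\<omega>. \<lambda>i\<in>I. Y i \<omega>) -` E \<inter> space N)"
    using arg_cong[OF eq, of "\<lambda>D. measure D E"] E mX mY by (simp add: measure_distr)
  moreover have "(\<lambda>\<omega>. \<lambda>i\<in>I. X i \<omega>) -` E \<inter> space M = {\<omega> \<in> space M. Q \<omega>}"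
    using measurable_space[OF mX] by (auto simp: E_def PX)
  moreover have "(\<lambda>\<omega>. \<lambda>i\<in>I. Y i \<omega>) -` E \<inter> space N = {\<omega> \<in> space N. R \<omega>}"
    using measurable_space[OF mY] by (auto simp: E_def PY)
  ultimately show ?thesis
    by simp
qed

section \<open>Association of nonnegatively correlated Gaussian variables\<close>

context centred_gaussian_space
begin

text \<open>The regression of the \<open>Y i\<close> on \<open>X\<close> has nonnegative slopes, and its residuals are independent
  of \<open>X\<close>. The conditional probability of \<open>\<forall>i. Y i \<ge> v i\<close> given \<open>X\<close> is thus a nondecreasing
  function of \<open>X\<close>, and Chebyshev's association inequality applies. Independence is expressed by
  moving the residuals to the second factor of \<open>M \<Otimes>\<^sub>M M\<close>.\<close>

lemma prob_atLeast_associated: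
  assumes X: "X \<in> L" "expectation (\<lambda>\<omega>. X \<omega> ^ 2) > 0" and I: "finite I"
    and Y: "\<And>i. i \<in> I \<Longrightarrow> Y i \<in> L"
    and cov: "\<And>i. i \<in> I \<Longrightarrow> expectation (\<lambda>\<omega>. X \<omega> * Y i \<omega>) \<ge> 0"
  shows "prob {\<omega> \<in> space M. u \<le> X \<omega>} * prob {\<omega> \<in> space M. \<forall>i\<in>I. v i \<le> Y i \<omega>} \<le>
    prob {\<omega> \<in> space M. u \<le> X \<omega> \<and> (\<forall>i\<in>I. v i \<le> Y i \<omega>)}"
proof -
  interpret N: pair_prob_space M M ..
  have [measurable]: "X \<in> borel_measurable M" "\<And>i. i \<in> I \<Longrightarrow> Y i \<in> borel_measurable M"
    using X Y by auto
  define b where "b i = expectation (\<lambda>\<omega>. X \<omega> * Y i \<omega>) / expectation (\<lambda>\<omega>. X \<omega> ^ 2)" for i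
  have b: "b i \<ge> 0" if "i \<in> I" for i
    using X cov[OF that] by (simp add: b_def)
  define W where "W i \<omega> = Y i \<omega> - b i * X \<omega>" for i \<omega>
  have W: "W i \<in> L" if "i \<in> I" for i
    unfolding W_def[abs_def] by (intro diff scale Y X that)
  have [measurable]: "\<And>i. i \<in> I \<Longrightarrow> W i \<in> borel_measurable M"
    using W by auto
  have XW: "expectation (\<lambda>\<omega>. X \<omega> * W i \<omega>) = 0" if "i \<in> I" for i
  proof -
    have "expectation (\<lambda>\<omega>. X \<omega> * W i \<omega>) = expectation (\<lambda>\<omega>. X \<omega> * Y i \<omega> - b i * (X \<omega> ^ 2))"
      by (simp add: W_def power2_eq_square algebra_simps)
    also have "\<dots> = expectation (\<lambda>\<omega>. X \<omega> * Y i \<omega>) - b i * expectation (\<lambda>\<omega>. X \<omega> ^ 2)"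
      using integrable_mult[OF X(1) Y[OF that]] integrable_power[OF X(1), of 2] by simp
    also have "\<dots> = 0"
      using X(2) by (simp add: b_def)
    finally show ?thesis .
  qed
  \<comment> \<open>\<open>None\<close> stands for \<open>X\<close> and \<open>Some i\<close> for
    \<open>Y i\<close>, so that one index set carries the joint law.\<close>
  define J where "J = insert None (Some ` I)"
  have J: "finite J"
    using I by (simp add: J_def)
  define U where "U j \<omega> = (case j of None \<Rightarrow> X \<omega> | Some i \<Rightarrow> Y i \<omega>)" for j \<omega>
  define V where "V j p = (case j of None \<Rightarrow> X (fst p) | Some i \<Rightarrow> W i (snd p) + b i * X (fst p))" for j p
  have U_meas: "U j \<in> borel_measurable M" if "j \<in> J" for j
    using that by (auto simp: J_def U_def[abs_def] X)
  have V_meas: "V j \<in> borel_measurable (M \<Otimes>\<^sub>M M)" if "j \<in> J" for j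
    using that by (auto simp: J_def V_def[abs_def])
  have distr: "distr M (Pi\<^sub>M J (\<lambda>_. borel)) (\<lambda>\<omega>. \<lambda>i\<in>J. U i \<omega>) =
      distr (M \<Otimes>\<^sub>M M) (Pi\<^sub>M J (\<lambda>_. borel)) (\<lambda>\<omega>. \<lambda>i\<in>J. V i \<omega>)"
  proof (rule distr_PiM_unique[OF prob_space_axioms N.prob_space_axioms J U_meas V_meas])
    fix \<theta> and c :: "'b option \<Rightarrow> real"
    define d where "d = c None + (\<Sum>i\<in>I. c (Some i) * b i)"
    define Q where "Q \<omega> = (\<Sum>i\<in>I. c (Some i) * W i \<omega>)" for \<omega>
    have dX: "(\<lambda>\<omega>. d * X \<omega>) \<in> L"
      by (intro scale X)
    have Q: "Q \<in> L"
      unfolding Q_def[abs_def] by (intro sum W)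
    have [measurable]: "Q \<in> borel_measurable M"
      using Q by auto
    have sumU: "(\<Sum>j\<in>J. c j * U j \<omega>) = d * X \<omega> + Q \<omega>" for \<omega>
      using I by (simp add: J_def U_def Q_def d_def W_def sum.reindex algebra_simps
          sum.distrib sum_subtractf sum_distrib_left sum_distrib_right)
    have sumV: "(\<Sum>j\<in>J. c j * V j p) = d * X (fst p) + Q (snd p)" for p
      using I by (simp add: J_def V_def Q_def d_def W_def sum.reindex algebra_simps
          sum.distrib sum_subtractf sum_distrib_left sum_distrib_right)
    have XQ: "expectation (\<lambda>\<omega>. X \<omega> * Q \<omega>) = 0"
    proof -
      have "expectation (\<lambda>\<omega>. X \<omega> * Q \<omega>) = expectation (\<lambda>\<omega>. \<Sum>i\<in>I. c (Some i) * (X \<omega> * W i \<omega>))"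
        by (simp add: Q_def sum_distrib_left mult_ac)
      also have "\<dots> = (\<Sum>i\<in>I. c (Some i) * expectation (\<lambda>\<omega>. X \<omega> * W i \<omega>))"
        using integrable_mult[OF X(1) W] by (simp add: Bochner_Integration.integral_sum)
      finally show ?thesis
        by (simp add: XW)
    qed
    \<comment> \<open>\<open>X\<close> and \<open>Q\<close> are uncorrelated, so the variances add
      and the exponential factors. The second factor is then read as the expected cosine of an
      independent copy of \<open>Q\<close>, with phase
      \<open>\<theta> + d * X \<omega>1\<close>.\<close>
    have "expectation (\<lambda>\<omega>. (d * X \<omega> + Q \<omega>)\<^sup>2) =
        expectation (\<lambda>\<omega>. (d * X \<omega>)\<^sup>2 + (Q \<omega>)\<^sup>2 + 2 * d * (X \<omega> * Q \<omega>))"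
      by (simp add: power2_sum mult_ac)
    also have "\<dots> = expectation (\<lambda>\<omega>. (d * X \<omega>)\<^sup>2) + expectation (\<lambda>\<omega>. (Q \<omega>)\<^sup>2)"
      using integrable_power[OF dX, of 2] integrable_power[OF Q, of 2] integrable_mult[OF X(1) Q] XQ
      by simp
    finally have "expectation (\<lambda>\<omega>. cos (\<theta> + (d * X \<omega> + Q \<omega>))) =
       (cos \<theta> * exp (- expectation (\<lambda>\<omega>. (d * X \<omega>)\<^sup>2) / 2)) * exp (- expectation (\<lambda>\<omega>. (Q \<omega>)\<^sup>2) / 2)"
      using expectation_cos[OF add[OF dX Q]] by (simp add: exp_add[symmetric] add_divide_distrib)
    also have "\<dots> = expectation (\<lambda>\<omega>. cos (\<theta> + d * X \<omega>)) * exp (- expectation (\<lambda>\<omega>. (Q \<omega>)\<^sup>2) / 2)"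
      using expectation_cos[OF dX] by simp
    also have "\<dots> = expectation (\<lambda>\<omega>. cos (\<theta> + d * X \<omega>) * exp (- expectation (\<lambda>\<omega>. (Q \<omega>)\<^sup>2) / 2))"
      by simp
    also have "\<dots> = expectation (\<lambda>\<omega>1. expectation (\<lambda>\<omega>2. cos (\<theta> + d * X \<omega>1 + Q \<omega>2)))"
      using expectation_cos[OF Q] by simp
    also have "\<dots> = (\<integral>p. cos (\<theta> + d * X (fst p) + Q (snd p)) \<partial>(M \<Otimes>\<^sub>M M))"
    proof -
      have "integrable (M \<Otimes>\<^sub>M M) (\<lambda>p. cos (\<theta> + d * X (fst p) + Q (snd p)))"
        by (intro N.integrable_const_bound[of _ 1]) auto
      from N.integral_fst'[OF this] show ?thesis
        by simp
    qed
    finally show "expectation (\<lambda>\<omega>. cos (\<theta> + (\<Sum>j\<in>J. c j * U j \<omega>))) =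
        (\<integral>p. cos (\<theta> + (\<Sum>j\<in>J. c j * V j p)) \<partial>(M \<Otimes>\<^sub>M M))"
      by (simp add: sumU sumV add.assoc)
  qed
  define g where "g x = prob {\<omega> \<in> space M. \<forall>i\<in>I. v i \<le> W i \<omega> + b i * x}" for x
  have g_mono: "g x \<le> g y" if "x \<le> y" for x y
    unfolding g_def
  proof (rule finite_measure_mono)
    show "{\<omega> \<in> space M. \<forall>i\<in>I. v i \<le> W i \<omega> + b i * x} \<subseteq> {\<omega> \<in> space M. \<forall>i\<in>I. v i \<le> W i \<omega> + b i * y}"
      using b mult_left_mono[OF that] by (fastforce intro: order_trans)
    show "{\<omega> \<in> space M. \<forall>i\<in>I. v i \<le> W i \<omega> + b i * y} \<in> events"
      using I by measurable
  qed
  have g01: "0 \<le> g x" "g x \<le> 1" for x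
    by (auto simp: g_def)
  have "prob {\<omega> \<in> space M. u \<le> X \<omega> \<and> (\<forall>i\<in>I. v i \<le> Y i \<omega>)} =
      measure (M \<Otimes>\<^sub>M M) {p \<in> space (M \<Otimes>\<^sub>M M). u \<le> X (fst p) \<and> (\<forall>i\<in>I. v i \<le> W i (snd p) + b i * X (fst p))}"
  proof (rule prob_eq_if_distr_PiM_eq[OF distr U_meas V_meas])
    have "None \<in> J" "\<And>i. i \<in> I \<Longrightarrow> Some i \<in> J"
      by (auto simp: J_def)
    then show "Measurable.pred (Pi\<^sub>M J (\<lambda>_. borel)) (\<lambda>x. u \<le> x None \<and> (\<forall>i\<in>I. v i \<le> x (Some i)))"
      using I by measurable
  qed (auto simp: J_def U_def V_def)
  also have "\<dots> = expectation (\<lambda>\<omega>. indicator {u..} (X \<omega>) * g (X \<omega>))"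
  proof -
    have "{p \<in> space (M \<Otimes>\<^sub>M M). u \<le> X (fst p) \<and> (\<forall>i\<in>I. v i \<le> W i (snd p) + b i * X (fst p))} \<in> sets (M \<Otimes>\<^sub>M M)"
      using I by measurable
    then have "measure (M \<Otimes>\<^sub>M M) {p \<in> space (M \<Otimes>\<^sub>M M). u \<le> X (fst p) \<and> (\<forall>i\<in>I. v i \<le> W i (snd p) + b i * X (fst p))}
      = expectation (\<lambda>\<omega>1. expectation (\<lambda>\<omega>2. indicator {p \<in> space (M \<Otimes>\<^sub>M M). u \<le> X (fst p) \<and> (\<forall>i\<in>I. v i \<le> W i (snd p) + b i * X (fst p))} (\<omega>1, \<omega>2)))"
      by (subst N.integral_fst') (auto simp: N.emeasure_eq_measure)
    also have "\<dots> = expectation (\<lambda>\<omega>1. indicator {u..} (X \<omega>1) * g (X \<omega>1))"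
    proof (rule Bochner_Integration.integral_cong[OF refl])
      fix \<omega>1 assume \<omega>1: "\<omega>1 \<in> space M"
      have [measurable]: "{\<omega> \<in> space M. \<forall>i\<in>I. v i \<le> W i \<omega> + b i * X \<omega>1} \<in> events"
        using I by measurable
      have "expectation (\<lambda>\<omega>2. indicator {p \<in> space (M \<Otimes>\<^sub>M M). u \<le> X (fst p) \<and> (\<forall>i\<in>I. v i \<le> W i (snd p) + b i * X (fst p))} (\<omega>1, \<omega>2))
        = expectation (\<lambda>\<omega>2. indicator {u..} (X \<omega>1) * indicator {\<omega> \<in> space M. \<forall>i\<in>I. v i \<le> W i \<omega> + b i * X \<omega>1} \<omega>2 :: real)"
        using \<omega>1 by (intro Bochner_Integration.integral_cong) (auto simp: indicator_def space_pair_measure)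
      then show "expectation (\<lambda>\<omega>2. indicator {p \<in> space (M \<Otimes>\<^sub>M M). u \<le> X (fst p) \<and> (\<forall>i\<in>I. v i \<le> W i (snd p) + b i * X (fst p))} (\<omega>1, \<omega>2)) = indicator {u..} (X \<omega>1) * g (X \<omega>1)"
        by (simp add: g_def)
    qed
    finally show ?thesis .
  qed
  finally have E1: "prob {\<omega> \<in> space M. u \<le> X \<omega> \<and> (\<forall>i\<in>I. v i \<le> Y i \<omega>)} =
      expectation (\<lambda>\<omega>. indicator {u..} (X \<omega>) * g (X \<omega>))" (is "_ = ?A") .
  have "prob {\<omega> \<in> space M. \<forall>i\<in>I. v i \<le> Y i \<omega>} =
      measure (M \<Otimes>\<^sub>M M) {p \<in> space (M \<Otimes>\<^sub>M M). \<forall>i\<in>I. v i \<le> W i (snd p) + b i * X (fst p)}"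
  proof (rule prob_eq_if_distr_PiM_eq[OF distr U_meas V_meas])
    have "\<And>i. i \<in> I \<Longrightarrow> Some i \<in> J"
      by (auto simp: J_def)
    then show "Measurable.pred (Pi\<^sub>M J (\<lambda>_. borel)) (\<lambda>x. \<forall>i\<in>I. v i \<le> x (Some i))"
      using I by measurable
  qed (auto simp: J_def U_def V_def)
  also have "\<dots> = expectation (\<lambda>\<omega>. g (X \<omega>))"
  proof -
    have "{p \<in> space (M \<Otimes>\<^sub>M M). \<forall>i\<in>I. v i \<le> W i (snd p) + b i * X (fst p)} \<in> sets (M \<Otimes>\<^sub>M M)"
      using I by measurable
    then have "measure (M \<Otimes>\<^sub>M M) {p \<in> space (M \<Otimes>\<^sub>M M). \<forall>i\<in>I. v i \<le> W i (snd p) + b i * X (fst p)}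
      = expectation (\<lambda>\<omega>1. expectation (\<lambda>\<omega>2. indicator {p \<in> space (M \<Otimes>\<^sub>M M). \<forall>i\<in>I. v i \<le> W i (snd p) + b i * X (fst p)} (\<omega>1, \<omega>2)))"
      by (subst N.integral_fst') (auto simp: N.emeasure_eq_measure)
    also have "\<dots> = expectation (\<lambda>\<omega>1. g (X \<omega>1))"
    proof (rule Bochner_Integration.integral_cong[OF refl])
      fix \<omega>1 assume \<omega>1: "\<omega>1 \<in> space M"
      have [measurable]: "{\<omega> \<in> space M. \<forall>i\<in>I. v i \<le> W i \<omega> + b i * X \<omega>1} \<in> events"
        using I by measurable
      have "expectation (\<lambda>\<omega>2. indicator {p \<in> space (M \<Otimes>\<^sub>M M). \<forall>i\<in>I. v i \<le> W i (snd p) + b i * X (fst p)} (\<omega>1, \<omega>2))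
        = expectation (\<lambda>\<omega>2. indicator {\<omega> \<in> space M. \<forall>i\<in>I. v i \<le> W i \<omega> + b i * X \<omega>1} \<omega>2 :: real)"
        using \<omega>1 by (intro Bochner_Integration.integral_cong) (auto simp: indicator_def space_pair_measure)
      then show "expectation (\<lambda>\<omega>2. indicator {p \<in> space (M \<Otimes>\<^sub>M M). \<forall>i\<in>I. v i \<le> W i (snd p) + b i * X (fst p)} (\<omega>1, \<omega>2)) = g (X \<omega>1)"
        by (simp add: g_def)
    qed
    finally show ?thesis .
  qed
  finally have E2: "prob {\<omega> \<in> space M. \<forall>i\<in>I. v i \<le> Y i \<omega>} = expectation (\<lambda>\<omega>. g (X \<omega>))" .
  have [measurable]: "g \<in> borel_measurable borel"
    using g_mono by (intro borel_measurable_mono monoI) auto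
  define p where "p = prob {\<omega> \<in> space M. u \<le> X \<omega>}"
  have p: "p = expectation (\<lambda>\<omega>. indicator {u..} (X \<omega>))"
  proof -
    have "expectation (\<lambda>\<omega>. indicator {u..} (X \<omega>)) = expectation (indicator {\<omega> \<in> space M. u \<le> X \<omega>} :: 'a \<Rightarrow> real)"
      by (intro Bochner_Integration.integral_cong) (auto simp: indicator_def)
    then show ?thesis
      by (simp add: p_def)
  qed
  have p01: "0 \<le> p" "p \<le> 1"
    by (auto simp: p_def)
  have int: "integrable M (\<lambda>\<omega>. indicator {u..} (X \<omega>) * g (X \<omega>))" "integrable M (\<lambda>\<omega>. g (X \<omega>))"
    "integrable M (\<lambda>\<omega>. indicator {u..} (X \<omega>) :: real)"
    using g01 by (auto intro!: integrable_const_bound[of _ 1] simp: indicator_def)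
  \<comment> \<open>Monotonicity is needed only relative to the threshold:
    \<open>g (X \<omega>)\<close> is at most \<open>g u\<close> below \<open>u\<close> and at least
    \<open>g u\<close> above it. The two resulting bounds, combined with weights \<open>p\<close>
    and \<open>1 - p\<close>, give the claim.\<close>
  have "expectation (\<lambda>\<omega>. g (X \<omega>)) \<le>
      expectation (\<lambda>\<omega>. indicator {u..} (X \<omega>) * g (X \<omega>) + g u * (1 - indicator {u..} (X \<omega>)))"
    using int by (intro integral_mono) (auto simp: indicator_def g_mono)
  also have "\<dots> = ?A + g u * (1 - p)"
    using int by (simp add: p prob_space)
  finally have G: "expectation (\<lambda>\<omega>. g (X \<omega>)) \<le> ?A + g u * (1 - p)" .
  have "expectation (\<lambda>\<omega>. indicator {u..} (X \<omega>) * g u) \<le> ?A"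
    using int by (intro integral_mono) (auto simp: indicator_def g_mono)
  then have "p * g u \<le> ?A"
    using int by (simp add: p)
  have "p * expectation (\<lambda>\<omega>. g (X \<omega>)) \<le> p * (?A + g u * (1 - p))"
    using G p01 by (intro mult_left_mono) auto
  also have "\<dots> = p * ?A + (1 - p) * (p * g u)"
    by (simp add: algebra_simps)
  also have "\<dots> \<le> p * ?A + (1 - p) * ?A"
    using \<open>p * g u \<le> ?A\<close> p01 by (intro add_left_mono mult_left_mono) auto
  also have "\<dots> = ?A"
    by (simp add: algebra_simps)
  finally show ?thesis
    by (simp add: E1 E2 p_def)
qed

end

subsection \<open>Chaining for fractional Brownian motion\<close>

text \<open>Turns a bound on a moment of order \<open>2 * q\<close> into one on a first moment, in
  place of integrating a Gaussian tail.\<close>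

lemma le_one_plus_even_power:
  fixes x :: real
  assumes "0 < q"
  shows "x \<le> 1 + x ^ (2 * q)"
proof (cases "x \<le> 1")
  case True
  then show ?thesis
    using zero_le_even_power'[of x q] by linarith
next
  case False
  then show ?thesis
    using self_le_power[of x "2 * q"] assms by simp
qed

text \<open>Here \<open>f k j\<close> is the value at \<open>k / 2 ^ j\<close>. The chain goes from
  \<open>k\<close> to its parent \<open>k div 2\<close> one level up: for even \<open>k\<close> this
  is the same point, for odd \<open>k\<close> it is the left neighbour. So every level contributes
  at most one link.\<close>

lemma dyadic_chain_bound:
  fixes f :: "nat \<Rightarrow> nat \<Rightarrow> real"
  assumes refine: "\<And>k j. f (2 * k) (Suc j) = f k j"
    and step: "\<And>i j. j \<le> m \<Longrightarrow> i < 2 ^ j \<Longrightarrow> \<bar>f (Suc i) j - f i j\<bar> \<le> w j"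
    and w: "\<And>j. 0 \<le> w j" and k: "k \<le> 2 ^ m"
  shows "\<bar>f k m - f 0 0\<bar> \<le> (\<Sum>j\<le>m. w j)"
  using step k
proof (induction m arbitrary: k)
  case 0
  then have "k = 0 \<or> k = 1"
    by auto
  then show ?case
    using 0(1)[of 0 0] w[of 0] by auto
next
  case (Suc m)
  define k' where "k' = k div 2"
  have "k' \<le> 2 ^ m"
    using Suc.prems(2) by (simp add: k'_def)
  then have IH: "\<bar>f k' m - f 0 0\<bar> \<le> (\<Sum>j\<le>m. w j)"
    using Suc.IH Suc.prems(1) by simp
  show ?case
  proof (cases "even k")
    case True
    then have "f k (Suc m) = f k' m"
      using refine[of k' m] by (simp add: k'_def)
    then show ?thesis
      using IH w[of "Suc m"] by simp
  next
    case False
    then have k: "k = Suc (2 * k')"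
      by (simp add: k'_def)
    have "2 * k' < 2 ^ Suc m"
      using Suc.prems(2) k by linarith
    then have "\<bar>f k (Suc m) - f k' m\<bar> \<le> w (Suc m)"
      using Suc.prems(1)[of "Suc m" "2 * k'"] refine[of k' m] k by simp
    then show ?thesis
      using IH by simp
  qed
qed

section \<open>The Gaussian space of the process and moments of its dyadic increments\<close>

context fractional_brownian_motion
begin

definition lin :: "('a \<Rightarrow> real) set" where
  "lin = {\<lambda>\<omega>. \<Sum>t\<in>F. c t * B t \<omega> | F c. finite F \<and> F \<subseteq> {0..}}"

lemma lin_base:
  assumes "0 \<le> t" shows "B t \<in> lin"
proof -
  have "B t = (\<lambda>\<omega>. \<Sum>s\<in>{t}. 1 * B s \<omega>)"
    by simp
  then show ?thesis
    unfolding lin_def using assms by (intro CollectI exI[of _ "{t}"] exI[of _ "\<lambda>_. 1"]) auto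
qed

lemma B_gaussian: "0 \<le> t \<Longrightarrow> gaussian_rv (B t)"
proof -
  assume "0 \<le> t"
  then have "gaussian_rv (\<lambda>\<omega>. \<Sum>i\<in>{t}. 1 * B i \<omega>)"
    by (intro gaussian[unfolded gaussian_process_def, rule_format]) auto
  then show ?thesis
    by simp
qed

sublocale G: centred_gaussian_space M lin
proof
  fix X Y :: "'a \<Rightarrow> real" and c :: real
  assume X: "X \<in> lin"
  then obtain F b where F: "finite F" "F \<subseteq> {0..}" and Xeq: "X = (\<lambda>\<omega>. \<Sum>t\<in>F. b t * B t \<omega>)"
    by (auto simp: lin_def)
  show "gaussian_rv X"
    unfolding Xeq using F by (intro gaussian[unfolded gaussian_process_def, rule_format]) auto
  have "integrable M (B t)" if "t \<in> F" for t
    using centred_gaussian_integrable_power[OF B_gaussian centered, of t 1] that F by auto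
  then show "expectation X = 0"
    unfolding Xeq using F centered by (simp add: Bochner_Integration.integral_sum subset_eq)
  have "(\<lambda>\<omega>. c * X \<omega>) = (\<lambda>\<omega>. \<Sum>t\<in>F. (c * b t) * B t \<omega>)"
    by (simp add: Xeq sum_distrib_left mult.assoc)
  then show "(\<lambda>\<omega>. c * X \<omega>) \<in> lin"
    unfolding lin_def using F by (intro CollectI exI[of _ F] exI[of _ "\<lambda>t. c * b t"]) auto
  assume "Y \<in> lin"
  then obtain F' b' where F': "finite F'" "F' \<subseteq> {0..}" and Yeq: "Y = (\<lambda>\<omega>. \<Sum>t\<in>F'. b' t * B t \<omega>)"
    by (auto simp: lin_def)
  define d where "d t = (if t \<in> F then b t else 0) + (if t \<in> F' then b' t else 0)" for t
  have "X \<omega> + Y \<omega> = (\<Sum>t\<in>F \<union> F'. d t * B t \<omega>)" for \<omega>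
  proof -
    have "X \<omega> = (\<Sum>t\<in>F \<union> F'. (if t \<in> F then b t else 0) * B t \<omega>)"
      unfolding Xeq using F F' by (intro sum.mono_neutral_cong_left) auto
    moreover have "Y \<omega> = (\<Sum>t\<in>F \<union> F'. (if t \<in> F' then b' t else 0) * B t \<omega>)"
      unfolding Yeq using F F' by (intro sum.mono_neutral_cong_left) auto
    ultimately show ?thesis
      by (simp add: d_def sum.distrib distrib_right)
  qed
  then show "(\<lambda>\<omega>. X \<omega> + Y \<omega>) \<in> lin"
    unfolding lin_def using F F' by (intro CollectI exI[of _ "F \<union> F'"] exI[of _ d]) auto
next
  show "(\<lambda>_. 0) \<in> lin"
    unfolding lin_def by (intro CollectI exI[of _ "{}"]) auto
qed

lemma increment_in_lin: "0 \<le> s \<Longrightarrow> 0 \<le> t \<Longrightarrow> (\<lambda>\<omega>. B t \<omega> - B s \<omega>) \<in> lin"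
  by (intro G.diff lin_base)

text \<open>The powers of the single times cancel, leaving only time differences. This is where
  stationarity of the increments and invariance under time reversal come from.\<close>

lemma increment_covariance:
  assumes "0 \<le> s" "0 \<le> t" "0 \<le> u" "0 \<le> v"
  shows "expectation (\<lambda>\<omega>. (B t \<omega> - B s \<omega>) * (B v \<omega> - B u \<omega>)) =
    (\<bar>t - u\<bar> powr (2 * H) + \<bar>s - v\<bar> powr (2 * H) -
     \<bar>t - v\<bar> powr (2 * H) - \<bar>s - u\<bar> powr (2 * H)) / 2"
proof -
  have i: "integrable M (\<lambda>\<omega>. B x \<omega> * B y \<omega>)" if "0 \<le> x" "0 \<le> y" for x y
    using that by (intro G.integrable_mult lin_base)
  have "expectation (\<lambda>\<omega>. (B t \<omega> - B s \<omega>) * (B v \<omega> - B u \<omega>)) =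
    expectation (\<lambda>\<omega>. B t \<omega> * B v \<omega> - B t \<omega> * B u \<omega> - B s \<omega> * B v \<omega> + B s \<omega> * B u \<omega>)"
    by (simp add: algebra_simps)
  also have "\<dots> = expectation (\<lambda>\<omega>. B t \<omega> * B v \<omega>) - expectation (\<lambda>\<omega>. B t \<omega> * B u \<omega>)
      - expectation (\<lambda>\<omega>. B s \<omega> * B v \<omega>) + expectation (\<lambda>\<omega>. B s \<omega> * B u \<omega>)"
    using assms by (simp add: i)
  also have "\<dots> = (\<bar>t - u\<bar> powr (2 * H) + \<bar>s - v\<bar> powr (2 * H) -
     \<bar>t - v\<bar> powr (2 * H) - \<bar>s - u\<bar> powr (2 * H)) / 2"
    using assms by (simp add: covariance) (simp add: field_simps)
  finally show ?thesis .
qed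

lemma increment_variance:
  assumes "0 \<le> s" "0 \<le> t"
  shows "expectation (\<lambda>\<omega>. (B t \<omega> - B s \<omega>)\<^sup>2) = \<bar>t - s\<bar> powr (2 * H)"
  using increment_covariance[OF assms assms] by (simp add: power2_eq_square abs_minus_commute)

lemma B_0: "AE \<omega> in M. B 0 \<omega> = 0"
proof -
  have "expectation (\<lambda>\<omega>. (B 0 \<omega>)\<^sup>2) = 0"
    using covariance[of 0 0] by (simp add: power2_eq_square)
  then show ?thesis
    using integral_nonneg_eq_0_iff_AE[OF G.integrable_power[OF lin_base[of 0], of 2]] by simp
qed

text \<open>The weights \<open>(1 - r) * r ^ j\<close> of the dyadic levels \<open>j\<close> in \<open>chain\<close> add up to 1, and the choice
  of \<open>r\<close> makes the expected level sums decay geometrically once \<open>2 \<le> H * q\<close>.\<close>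

definition r :: real where "r = 2 powr (- H / 2)"

lemma r: "0 < r" "r < 1"
proof -
  have "2 powr (- H / 2) < (2::real) powr 0"
    using hurst_parameter by (intro powr_less_mono) auto
  then show "0 < r" "r < 1"
    by (auto simp: r_def)
qed

text \<open>A sum over all links stands in for the largest one: it still dominates each link, and
  its expectation can be computed term by term.\<close>

definition chain :: "real \<Rightarrow> real \<Rightarrow> nat \<Rightarrow> nat \<Rightarrow> 'a \<Rightarrow> real" where
  "chain s l q m \<omega> = (\<Sum>j\<le>m. \<Sum>i<2 ^ j.
    ((B (s + real (Suc i) * l / 2 ^ j) \<omega> - B (s + real i * l / 2 ^ j) \<omega>) / ((1 - r) * r ^ j)) ^ (2 * q))"

lemma increment_even_moment:
  assumes "0 \<le> s" "0 \<le> t" "q > 0"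
  shows "expectation (\<lambda>\<omega>. (B t \<omega> - B s \<omega>) ^ (2 * q)) \<le> real q ^ q * \<bar>t - s\<bar> powr (2 * H * q)"
proof -
  have "(\<bar>t - s\<bar> powr (2 * H)) ^ q = \<bar>t - s\<bar> powr (2 * H * q)"
    using assms(3) by (cases "t = s") (auto simp: powr_power mult_ac)
  then show ?thesis
    using G.even_moment[OF increment_in_lin[OF assms(1,2)] assms(3)] increment_variance[OF assms(1,2)]
    by (simp add: power_mult_distrib)
qed

lemma chain_nonneg: "0 \<le> chain s l q m \<omega>"
  unfolding chain_def by (intro sum_nonneg) (auto simp: power_even_eq)

lemma chain_mono: "m \<le> m' \<Longrightarrow> chain s l q m \<omega> \<le> chain s l q m' \<omega>"
  unfolding chain_def by (intro sum_mono2) (auto simp: power_even_eq intro!: sum_nonneg)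

lemma
  assumes "0 \<le> s" "0 < l" "q > 0"
  shows chain_integrable: "integrable M (chain s l q m)"
    and chain_expectation: "2 \<le> H * q \<Longrightarrow>
      expectation (chain s l q m) \<le> 2 * real q ^ q * (l powr H / (1 - r)) ^ (2 * q)"
proof -
  define D where "D i j \<omega> =
    ((B (s + real (Suc i) * l / 2 ^ j) \<omega> - B (s + real i * l / 2 ^ j) \<omega>) / ((1 - r) * r ^ j)) ^ (2 * q)"
    for i j \<omega>
  have int: "integrable M (D i j)" for i j
    unfolding D_def[abs_def] power_divide using assms
    by (intro integrable_divide_zero G.integrable_power increment_in_lin) auto
  have chain: "chain s l q m = (\<lambda>\<omega>. \<Sum>j\<le>m. \<Sum>i<2 ^ j. D i j \<omega>)"
    by (simp add: chain_def[abs_def] D_def)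
  show "integrable M (chain s l q m)"
    unfolding chain using int by auto
  assume q: "2 \<le> H * q"
  define A where "A = real q ^ q * (l powr H / (1 - r)) ^ (2 * q)"
  have A: "0 \<le> A"
    using r by (simp add: A_def)
  \<comment> \<open>The moment of a link at level \<open>j\<close> carries the factor
    \<open>r ^ (4 * q * j)\<close>, and the weights use up \<open>r ^ (2 * q * j)\<close>. What
    remains is \<open>2 powr (- (H * q))\<close> to the power \<open>j\<close>, at most
    \<open>1 / 4 ^ j\<close>, which outweighs the \<open>2 ^ j\<close> links of the level.\<close>
  have D: "expectation (D i j) \<le> A / 4 ^ j" for i j
  proof -
    have "expectation (D i j) =
      expectation (\<lambda>\<omega>. (B (s + real (Suc i) * l / 2 ^ j) \<omega> - B (s + real i * l / 2 ^ j) \<omega>) ^ (2 * q)) /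
        ((1 - r) * r ^ j) ^ (2 * q)"
      unfolding D_def[abs_def] power_divide by simp
    also have "\<dots> \<le> real q ^ q * \<bar>(s + real (Suc i) * l / 2 ^ j) - (s + real i * l / 2 ^ j)\<bar> powr (2 * H * q) /
        ((1 - r) * r ^ j) ^ (2 * q)"
      using assms r by (intro divide_right_mono increment_even_moment) auto
    also have "(s + real (Suc i) * l / 2 ^ j) - (s + real i * l / 2 ^ j) = l / 2 ^ j"
      by (simp add: field_simps)
    also have "\<bar>l / 2 ^ j\<bar> powr (2 * H * q) = (l powr H) ^ (2 * q) * (2 powr (- H / 2)) ^ (4 * q * j)"
      using assms by (simp add: powr_divide powr_power powr_minus powr_realpow[symmetric] powr_powr field_simps)
    also have "(2 powr (- H / 2)) ^ (4 * q * j) = (r ^ j) ^ (2 * q) * (r ^ j) ^ (2 * q)"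
      unfolding r_def[symmetric] by (simp add: power_mult[symmetric] power_add[symmetric] algebra_simps)
    also have "real q ^ q * ((l powr H) ^ (2 * q) * ((r ^ j) ^ (2 * q) * (r ^ j) ^ (2 * q))) /
        ((1 - r) * r ^ j) ^ (2 * q) = A * (r ^ j) ^ (2 * q)"
      using r by (simp add: A_def power_divide power_mult_distrib)
    also have "(r ^ j) ^ (2 * q) = (2 powr (- (H * q))) ^ j"
      by (simp add: r_def powr_power mult_ac)
    also have "\<dots> \<le> (2 powr (- 2)) ^ j"
      using q by (intro power_mono powr_mono) auto
    also have "\<dots> = 1 / 4 ^ j"
      by (simp add: powr_minus power_divide power_inverse inverse_eq_divide)
    finally show ?thesis
      using A by (simp add: mult_left_mono)
  qed
  have "expectation (chain s l q m) = (\<Sum>j\<le>m. \<Sum>i<2 ^ j. expectation (D i j))"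
    unfolding chain using int by (simp add: Bochner_Integration.integral_sum)
  also have "\<dots> \<le> (\<Sum>j\<le>m. \<Sum>i<(2::nat) ^ j. A / 4 ^ j)"
    using D by (intro sum_mono) auto
  also have "\<dots> = A * (\<Sum>j\<le>m. (1 / 2) ^ j)"
  proof -
    have "(2::real) ^ j * (A / 4 ^ j) = A * (1 / 2) ^ j" for j
    proof -
      have "(4::real) ^ j = 2 ^ j * 2 ^ j"
        by (simp add: power_mult_distrib[symmetric])
      then show ?thesis
        by (simp add: power_divide)
    qed
    then show ?thesis
      by (simp add: sum_distrib_left)
  qed
  also have "\<dots> \<le> A * 2"
  proof -
    have "(\<Sum>j\<le>m. (1 / 2 :: real) ^ j) \<le> (\<Sum>j. (1 / 2) ^ j)"
      by (intro sum_le_suminf summable_geometric) auto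
    also have "\<dots> = 2"
      by (subst suminf_geometric) auto
    finally show ?thesis
      using A by (intro mult_left_mono)
  qed
  finally show "expectation (chain s l q m) \<le> 2 * real q ^ q * (l powr H / (1 - r)) ^ (2 * q)"
    by (simp add: A_def)
qed

text \<open>With \<open>A ^ (2 * q)\<close> equal to the chain sum, every link at level
  \<open>j\<close> is at most \<open>(1 - r) * r ^ j * A\<close>, and these bounds add up to at most
  \<open>A\<close>.\<close>

lemma increment_le_chain:
  assumes "k \<le> 2 ^ m" "q > 0"
  shows "(B (s + real k * l / 2 ^ m) \<omega> - B s \<omega>) ^ (2 * q) \<le> chain s l q m \<omega>"
proof -
  define f where "f k j = B (s + real k * l / 2 ^ j) \<omega>" for k j
  define A where "A = root (2 * q) (chain s l q m \<omega>)"
  have A: "0 \<le> A" "A ^ (2 * q) = chain s l q m \<omega>"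
    using assms chain_nonneg by (auto simp: A_def)
  have "\<bar>f k m - f 0 0\<bar> \<le> (\<Sum>j\<le>m. (1 - r) * r ^ j * A)"
  proof (rule dyadic_chain_bound)
    show "f (2 * k) (Suc j) = f k j" for k j
      by (simp add: f_def)
    show "0 \<le> (1 - r) * r ^ j * A" for j
      using r A by simp
    show "\<bar>f (Suc i) j - f i j\<bar> \<le> (1 - r) * r ^ j * A" if "j \<le> m" "i < 2 ^ j" for i j
    proof -
      define w where "w = (1 - r) * r ^ j"
      have w: "w > 0"
        using r by (simp add: w_def)
      have "\<bar>(f (Suc i) j - f i j) / w\<bar> ^ (2 * q) = ((f (Suc i) j - f i j) / w) ^ (2 * q)"
        by (rule power_even_abs) simp
      also have "\<dots> \<le> (\<Sum>i<2 ^ j. ((f (Suc i) j - f i j) / w) ^ (2 * q))"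
        using that by (intro member_le_sum) (auto simp: power_even_eq)
      also have "\<dots> \<le> chain s l q m \<omega>"
        unfolding chain_def f_def w_def using that
        by (intro member_le_sum[of j "{..m}" "\<lambda>j. \<Sum>i<2 ^ j. _ i j"]) (auto simp: power_even_eq intro!: sum_nonneg)
      also have "\<dots> = A ^ (2 * q)"
        by (simp add: A)
      finally have "\<bar>(f (Suc i) j - f i j) / w\<bar> \<le> A"
        using A(1) assms(2) by (subst (asm) power_mono_iff) auto
      then show ?thesis
        using w by (simp add: w_def[symmetric] abs_div_pos[symmetric] field_simps abs_mult)
    qed
  qed fact
  also have "\<dots> = A * ((1 - r) * (\<Sum>j\<le>m. r ^ j))"
    by (simp add: sum_distrib_left mult_ac)
  also have "(1 - r) * (\<Sum>j\<le>m. r ^ j) \<le> 1"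
    using r by (simp add: sum_gp_basic)
  then have "A * ((1 - r) * (\<Sum>j\<le>m. r ^ j)) \<le> A"
    using A(1) by (simp add: mult_left_le)
  finally have "\<bar>f k m - f 0 0\<bar> ^ (2 * q) \<le> A ^ (2 * q)"
    by (intro power_mono) auto
  then show ?thesis
    by (simp add: A f_def power_even_abs)
qed

subsection \<open>Running maximum and running minimum on a mesh\<close>

text \<open>Subtracting \<open>B 0\<close>, which vanishes only almost surely, makes \<open>Z d 0 = 0\<close> hold everywhere.\<close>

definition Z :: "real \<Rightarrow> nat \<Rightarrow> 'a \<Rightarrow> real" where
  "Z d k \<omega> = B (real k * d) \<omega> - B 0 \<omega>"

definition run_max :: "real \<Rightarrow> nat \<Rightarrow> 'a \<Rightarrow> real" where
  "run_max d n \<omega> = Max ((\<lambda>k. Z d k \<omega>) ` {..n})"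

text \<open>Index 0 is left out because \<open>Z d 0 = 0\<close> would force the value 0;
  \<open>run_max\<close> keeps it and is therefore nonnegative. For \<open>n = 0\<close> the minimum
  ranges over the empty set, hence the premises \<open>1 \<le> n\<close> below.\<close>

definition pos_min :: "real \<Rightarrow> nat \<Rightarrow> 'a \<Rightarrow> real" where
  "pos_min d n \<omega> = max 0 (Min ((\<lambda>k. Z d k \<omega>) ` {1..n}))"

lemma Z_0 [simp]: "Z d 0 \<omega> = 0"
  by (simp add: Z_def)

lemma Z_in_lin: "0 \<le> d \<Longrightarrow> Z d k \<in> lin"
  unfolding Z_def[abs_def] by (intro increment_in_lin) auto

lemma Z_measurable [measurable]: "0 \<le> d \<Longrightarrow> Z d k \<in> borel_measurable M"
  by (intro G.measurable Z_in_lin)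

lemma Z_integrable: "0 \<le> d \<Longrightarrow> integrable M (Z d k)"
  by (intro G.integrable Z_in_lin)

lemma Z_diff_covariance:
  assumes "0 \<le> d"
  shows "expectation (\<lambda>\<omega>. (Z d t \<omega> - Z d s \<omega>) * (Z d v \<omega> - Z d u \<omega>)) =
    d powr (2 * H) * (\<bar>real t - real u\<bar> powr (2 * H) + \<bar>real s - real v\<bar> powr (2 * H) -
     \<bar>real t - real v\<bar> powr (2 * H) - \<bar>real s - real u\<bar> powr (2 * H)) / 2"
proof -
  have "\<bar>real a * d - real b * d\<bar> powr (2 * H) = d powr (2 * H) * \<bar>real a - real b\<bar> powr (2 * H)" for a b
    using assms by (simp add: left_diff_distrib[symmetric] abs_mult powr_mult)
  then show ?thesis
    using increment_covariance[of "real s * d" "real t * d" "real u * d" "real v * d"] assms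
    by (simp add: Z_def algebra_simps)
qed

lemma Z_variance:
  assumes "0 \<le> d"
  shows "expectation (\<lambda>\<omega>. (Z d k \<omega>)\<^sup>2) = (real k * d) powr (2 * H)"
  using increment_variance[of 0 "real k * d"] assms by (simp add: Z_def)

lemma run_max_integrable:
  assumes "0 \<le> d"
  shows "integrable M (run_max d n)"
proof (rule Bochner_Integration.integrable_bound)
  show "integrable M (\<lambda>\<omega>. \<Sum>k\<le>n. \<bar>Z d k \<omega>\<bar>)"
    using assms Z_integrable by auto
  show "run_max d n \<in> borel_measurable M"
    unfolding run_max_def[abs_def] using assms by measurable
  show "AE \<omega> in M. norm (run_max d n \<omega>) \<le> norm (\<Sum>k\<le>n. \<bar>Z d k \<omega>\<bar>)"
  proof (rule AE_I2)
    fix \<omega>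
    have "run_max d n \<omega> \<in> (\<lambda>k. Z d k \<omega>) ` {..n}"
      unfolding run_max_def by (intro Max_in) auto
    then obtain k where k: "k \<le> n" "run_max d n \<omega> = Z d k \<omega>"
      by auto
    have "\<bar>Z d k \<omega>\<bar> \<le> (\<Sum>k\<le>n. \<bar>Z d k \<omega>\<bar>)"
      using k(1) by (intro member_le_sum) auto
    then show "norm (run_max d n \<omega>) \<le> norm (\<Sum>k\<le>n. \<bar>Z d k \<omega>\<bar>)"
      by (simp add: k(2))
  qed
qed

lemma pos_min_measurable: "0 \<le> d \<Longrightarrow> pos_min d n \<in> borel_measurable M"
  unfolding pos_min_def[abs_def] by measurable

lemma pos_min_nonneg: "0 \<le> pos_min d n \<omega>"
  by (simp add: pos_min_def)

lemma pos_min_le: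
  assumes "1 \<le> n" shows "pos_min d n \<omega> \<le> \<bar>Z d 1 \<omega>\<bar>"
proof -
  have "Min ((\<lambda>k. Z d k \<omega>) ` {1..n}) \<le> Z d 1 \<omega>"
    using assms by (intro Min_le) auto
  then show ?thesis
    by (auto simp: pos_min_def)
qed

lemma pos_min_integrable:
  assumes "0 \<le> d" "1 \<le> n"
  shows "integrable M (pos_min d n)"
proof (rule Bochner_Integration.integrable_bound)
  show "integrable M (\<lambda>\<omega>. \<bar>Z d 1 \<omega>\<bar>)"
    using assms Z_integrable by auto
  show "pos_min d n \<in> borel_measurable M"
    using assms by (intro pos_min_measurable)
  show "AE \<omega> in M. norm (pos_min d n \<omega>) \<le> norm \<bar>Z d 1 \<omega>\<bar>"
    using pos_min_le[OF assms(2)] pos_min_nonneg by (intro AE_I2) simp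
qed

lemma pos_min_antimono:
  assumes "0 \<le> d" "1 \<le> m" "m \<le> n"
  shows "expectation (pos_min d n) \<le> expectation (pos_min d m)"
proof (rule integral_mono)
  fix \<omega>
  have "Min ((\<lambda>k. Z d k \<omega>) ` {1..n}) \<le> Min ((\<lambda>k. Z d k \<omega>) ` {1..m})"
    using assms by (intro Min_antimono) auto
  then show "pos_min d n \<omega> \<le> pos_min d m \<omega>"
    by (simp add: pos_min_def)
qed (use assms in \<open>auto intro: pos_min_integrable\<close>)

text \<open>The maximum grows by the positive part of \<open>Z d (Suc n) - run_max d n\<close>. This
  difference is the minimum of the increments from the earlier mesh points to the last one, indexed
  by their length \<open>j\<close>.\<close>

lemma run_max_Suc:
  "run_max d (Suc n) \<omega> = run_max d n \<omega> +
    max 0 (Min ((\<lambda>j. Z d (Suc n) \<omega> - Z d (Suc n - j) \<omega>) ` {1..Suc n}))"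
proof -
  have *: "Min ((\<lambda>j. Z d (Suc n) \<omega> - Z d (Suc n - j) \<omega>) ` {1..Suc n}) = Z d (Suc n) \<omega> - run_max d n \<omega>"
  proof (rule Min_eqI)
    have "run_max d n \<omega> \<in> (\<lambda>k. Z d k \<omega>) ` {..n}"
      unfolding run_max_def by (intro Max_in) auto
    then obtain k where k: "k \<le> n" "run_max d n \<omega> = Z d k \<omega>"
      by auto
    then show "Z d (Suc n) \<omega> - run_max d n \<omega> \<in> (\<lambda>j. Z d (Suc n) \<omega> - Z d (Suc n - j) \<omega>) ` {1..Suc n}"
      by (intro image_eqI[of _ _ "Suc n - k"]) auto
    show "Z d (Suc n) \<omega> - run_max d n \<omega> \<le> y"
      if "y \<in> (\<lambda>j. Z d (Suc n) \<omega> - Z d (Suc n - j) \<omega>) ` {1..Suc n}" for y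
    proof -
      from that obtain j where j: "1 \<le> j" "j \<le> Suc n" "y = Z d (Suc n) \<omega> - Z d (Suc n - j) \<omega>"
        by auto
      have "Z d (Suc n - j) \<omega> \<le> run_max d n \<omega>"
        unfolding run_max_def using j by (intro Max_ge) auto
      then show ?thesis
        by (simp add: j)
    qed
  qed simp
  have "run_max d (Suc n) \<omega> = max (Z d (Suc n) \<omega>) (run_max d n \<omega>)"
    unfolding run_max_def atMost_Suc image_insert by (intro Max_insert) auto
  then show ?thesis
    unfolding * by simp
qed

lemma expectation_run_max_Suc:
  assumes "0 \<le> d"
  shows "expectation (run_max d (Suc n)) = expectation (run_max d n) + expectation (pos_min d (Suc n))"
proof -
  define X where "X j \<omega> = Z d (Suc n) \<omega> - Z d (Suc n - j) \<omega>" for j \<omega>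
  let ?I = "{1..Suc n}"
  have X: "X j \<in> lin" for j
    unfolding X_def[abs_def] using assms by (intro G.diff Z_in_lin)
  have distr: "distr M (Pi\<^sub>M ?I (\<lambda>_. borel)) (\<lambda>\<omega>. \<lambda>i\<in>?I. X i \<omega>) =
    distr M (Pi\<^sub>M ?I (\<lambda>_. borel)) (\<lambda>\<omega>. \<lambda>i\<in>?I. Z d i \<omega>)"
  proof (rule gaussian_distr_PiM_eq)
    \<comment> \<open>Increments of lengths \<open>i\<close> and \<open>j\<close> with a common
      right end have the same covariance as those with common left end 0.\<close>
    show "expectation (\<lambda>\<omega>. X i \<omega> * X j \<omega>) = expectation (\<lambda>\<omega>. Z d i \<omega> * Z d j \<omega>)"
      if "i \<in> ?I" "j \<in> ?I" for i j
      using Z_diff_covariance[OF assms, of "Suc n" "Suc n - i" "Suc n" "Suc n - j"]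
        Z_diff_covariance[OF assms, of i 0 j 0] that
      by (simp add: X_def of_nat_diff abs_minus_commute add.commute)
  qed (use assms in \<open>auto intro: X Z_in_lin G.centred_gaussian_space_axioms\<close>)
  define f where "f x = max 0 (Min ((\<lambda>j. x j) ` ?I))" for x :: "nat \<Rightarrow> real"
  have f: "f \<in> borel_measurable (Pi\<^sub>M ?I (\<lambda>_. borel))"
    unfolding f_def[abs_def]
    by (intro borel_measurable_max borel_measurable_const borel_measurable_Min[where f = "\<lambda>i x. x i"]) auto
  have fX: "f (\<lambda>i\<in>?I. X i \<omega>) = max 0 (Min ((\<lambda>j. X j \<omega>) ` ?I))" for \<omega>
    unfolding f_def by (intro arg_cong[of _ _ "\<lambda>S. max 0 (Min S)"] image_cong) auto
  have fZ: "f (\<lambda>i\<in>?I. Z d i \<omega>) = pos_min d (Suc n) \<omega>" for \<omega>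
    unfolding f_def pos_min_def by (intro arg_cong[of _ _ "\<lambda>S. max 0 (Min S)"] image_cong) auto
  have "expectation (\<lambda>\<omega>. max 0 (Min ((\<lambda>j. X j \<omega>) ` ?I))) = expectation (pos_min d (Suc n))"
    by (rule expectation_eq_if_distr_PiM_eq[OF distr _ _ f fX fZ])
       (use X assms in \<open>auto intro: G.measurable Z_in_lin\<close>)
  moreover have step: "run_max d (Suc n) \<omega> = run_max d n \<omega> + max 0 (Min ((\<lambda>j. X j \<omega>) ` ?I))" for \<omega>
    unfolding X_def by (rule run_max_Suc)
  have "integrable M (\<lambda>\<omega>. run_max d (Suc n) \<omega> - run_max d n \<omega>)"
    using assms run_max_integrable by auto
  then have "integrable M (\<lambda>\<omega>. max 0 (Min ((\<lambda>j. X j \<omega>) ` ?I)))"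
    unfolding step by simp
  then have "expectation (run_max d (Suc n)) =
      expectation (run_max d n) + expectation (\<lambda>\<omega>. max 0 (Min ((\<lambda>j. X j \<omega>) ` ?I)))"
    using run_max_integrable[OF assms, of n] by (simp add: step[THEN ext])
  ultimately show ?thesis
    by simp
qed

lemma expectation_run_max:
  assumes "0 \<le> d"
  shows "expectation (run_max d n) = (\<Sum>k=1..n. expectation (pos_min d k))"
proof (induction n)
  case 0
  then show ?case
    by (simp add: run_max_def[abs_def])
next
  case (Suc n)
  then show ?case
    by (simp add: expectation_run_max_Suc[OF assms])
qed

text \<open>\<open>q\<close> is the least integer with \<open>2 \<le> H * q\<close>. The summand 1
  comes from \<open>le_one_plus_even_power\<close>, the other one from
  \<open>chain_expectation\<close> at unit scale, and the leading factor 2 from rounding the number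
  of mesh points up to a power of two.\<close>

definition run_max_const :: real where
  "run_max_const = (let q = nat \<lceil>2 / H\<rceil> in 2 * (1 + 2 * real q ^ q * (1 / (1 - r)) ^ (2 * q)))"

lemma run_max_const_pos: "0 < run_max_const"
  unfolding run_max_const_def Let_def using r by (intro mult_pos_pos add_pos_nonneg) auto

text \<open>One chain sum dominates all mesh values at once, and its expectation is bounded
  independently of the number of levels, so only the length of the time interval enters.\<close>

lemma expectation_run_max_le:
  assumes d: "0 < d" and n: "1 \<le> n"
  shows "expectation (run_max d n) \<le> run_max_const * (real n * d) powr H"
proof -
  define q where "q = nat \<lceil>2 / H\<rceil>"
  have "2 / H \<le> real q"
    unfolding q_def by (rule real_nat_ceiling_ge)
  then have q: "2 \<le> H * q"
    using hurst_parameter by (simp add: field_simps)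
  then have "q > 0"
    by (cases "q = 0") auto
  define C where "C = 2 * real q ^ q * (1 / (1 - r)) ^ (2 * q)"
  have C: "0 \<le> C"
    using r by (simp add: C_def)
  obtain m where m: "n \<le> 2 ^ m" "2 ^ m \<le> 2 * n"
  proof -
    define m where "m = (LEAST m. n \<le> 2 ^ m)"
    have ex: "n \<le> 2 ^ n"
      by (simp add: less_imp_le)
    then have 1: "n \<le> 2 ^ m"
      unfolding m_def by (rule LeastI)
    have "2 ^ m \<le> 2 * n"
    proof (cases m)
      case (Suc k)
      then have "\<not> n \<le> 2 ^ k"
        using not_less_Least[of k "\<lambda>m. n \<le> 2 ^ m"] by (simp add: m_def)
      with Suc show ?thesis
        by simp
    qed (use n in simp)
    with 1 that show ?thesis
      by blast
  qed
  \<comment> \<open>With this length the mesh points \<open>k * d\<close> are exactly the dyadic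
    points of level \<open>m\<close>.\<close>
  define l where "l = 2 ^ m * d"
  have l: "0 < l"
    using d by (simp add: l_def)
  define L where "L = l powr H"
  have L: "0 < L"
    using l by (simp add: L_def)
  have bound: "run_max d n \<omega> \<le> L * (1 + chain 0 l q m \<omega> / L ^ (2 * q))" for \<omega>
  proof -
    have "run_max d n \<omega> \<in> (\<lambda>k. Z d k \<omega>) ` {..n}"
      unfolding run_max_def by (intro Max_in) auto
    then obtain k where k: "k \<le> n" "run_max d n \<omega> = Z d k \<omega>"
      by auto
    have ch: "Z d k \<omega> ^ (2 * q) \<le> chain 0 l q m \<omega>"
      using increment_le_chain[of k m q 0 l \<omega>] k m(1) \<open>q > 0\<close> by (simp add: Z_def l_def)
    from le_one_plus_even_power[OF \<open>q > 0\<close>, of "Z d k \<omega> / L"] have "Z d k \<omega> / L \<le> 1 + Z d k \<omega> ^ (2 * q) / L ^ (2 * q)"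
      by (simp add: power_divide)
    also have "\<dots> \<le> 1 + chain 0 l q m \<omega> / L ^ (2 * q)"
      using ch L by (intro add_left_mono divide_right_mono) auto
    finally show ?thesis
      using L by (simp add: k(2) field_simps)
  qed
  have int: "integrable M (chain 0 l q m)"
    using l \<open>q > 0\<close> by (intro chain_integrable) auto
  have "expectation (run_max d n) \<le> expectation (\<lambda>\<omega>. L * (1 + chain 0 l q m \<omega> / L ^ (2 * q)))"
    using d int bound by (intro integral_mono run_max_integrable) auto
  also have "\<dots> = L * (1 + expectation (chain 0 l q m) / L ^ (2 * q))"
    using int by (simp add: prob_space)
  also have "\<dots> \<le> L * (1 + 2 * real q ^ q * (L / (1 - r)) ^ (2 * q) / L ^ (2 * q))"
    unfolding L_def using q l \<open>q > 0\<close>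
    by (intro mult_left_mono add_left_mono divide_right_mono chain_expectation) auto
  also have "2 * real q ^ q * (L / (1 - r)) ^ (2 * q) / L ^ (2 * q) = C"
    using L by (simp add: C_def power_divide)
  also have "L \<le> 2 * (real n * d) powr H"
  proof -
    have "l \<le> 2 * (real n * d)"
    proof -
      have "real (2 ^ m) \<le> real (2 * n)"
        using m(2) by (rule of_nat_mono)
      then show ?thesis
        using mult_right_mono[of "2 ^ m" "2 * real n" d] d by (simp add: l_def mult.assoc)
    qed
    then have "L \<le> (2 * (real n * d)) powr H"
      unfolding L_def using l hurst_parameter by (intro powr_mono2) auto
    also have "\<dots> = 2 powr H * (real n * d) powr H"
      using d by (simp add: powr_mult)
    also have "\<dots> \<le> 2 powr 1 * (real n * d) powr H"
      using hurst_parameter by (intro mult_right_mono powr_mono) auto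
    finally show ?thesis
      by simp
  qed
  then have "L * (1 + C) \<le> 2 * (real n * d) powr H * (1 + C)"
    using C by (intro mult_right_mono) auto
  finally show ?thesis
    by (simp add: run_max_const_def q_def[symmetric] C_def Let_def algebra_simps)
qed

lemma pos_min_upper:
  assumes "0 < d" "1 \<le> n"
  shows "expectation (pos_min d n) \<le> run_max_const * (real n * d) powr H / real n"
proof -
  have "real n * expectation (pos_min d n) = (\<Sum>k=1..n. expectation (pos_min d n))"
    by simp
  also have "\<dots> \<le> (\<Sum>k=1..n. expectation (pos_min d k))"
    using assms by (intro sum_mono pos_min_antimono) auto
  also have "\<dots> = expectation (run_max d n)"
    using assms by (simp add: expectation_run_max)
  also have "\<dots> \<le> run_max_const * (real n * d) powr H"
    using assms by (intro expectation_run_max_le)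
  finally show ?thesis
    using assms by (simp add: field_simps)
qed

text \<open>The expected maximum is at most \<open>run_max_const * (n * d) powr H\<close> at step
  \<open>n\<close>, and at step \<open>K * n\<close> it is at least a constant times
  \<open>(K * n * d) powr H\<close>. For large \<open>K\<close> the gap is at least
  \<open>(n * d) powr H\<close>. It is made up by at most \<open>K * n\<close> summands, none
  exceeding the expected positive part at \<open>n\<close>.\<close>

lemma pos_min_lower:
  obtains c where "c > 0"
    "\<And>d n. 0 < d \<Longrightarrow> 1 \<le> n \<Longrightarrow> c * ((real n * d) powr H / real n) \<le> expectation (pos_min d n)"
proof -
  \<comment> \<open>The mean of the positive part of a standard normal variable, half of its
    absolute moment.\<close>
  define \<kappa> :: real where "\<kappa> = sqrt (2 / pi) / 2"
  have \<kappa>: "\<kappa> > 0"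
    by (simp add: \<kappa>_def)
  \<comment> \<open>Solves \<open>run_max_const + 1 \<le> \<kappa> * K powr H\<close>; the extra 1
    on the left is the gap that remains.\<close>
  define K where "K = nat \<lceil>((run_max_const + 1) / \<kappa>) powr (1 / H)\<rceil> + 1"
  have K: "1 \<le> K"
    by (simp add: K_def)
  have "((run_max_const + 1) / \<kappa>) powr (1 / H) \<le> real K"
    unfolding K_def by linarith
  then have "(((run_max_const + 1) / \<kappa>) powr (1 / H)) powr H \<le> real K powr H"
    using hurst_parameter by (intro powr_mono2) auto
  then have KH: "run_max_const + 1 \<le> \<kappa> * real K powr H"
    using hurst_parameter \<kappa> run_max_const_pos by (simp add: powr_powr field_simps)
  show ?thesis
  proof (rule that[of "1 / real K"])
    fix d :: real and n :: nat
    assume d: "0 < d" and n: "1 \<le> n"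
    have "\<kappa> * (real (K * n) * d) powr H \<le> expectation (run_max d (K * n))"
    proof -
      define N where "N = K * n"
      have int: "integrable M (Z d N)"
        using d by (intro Z_integrable) auto
      have E0: "expectation (Z d N) = 0"
        using d by (intro G.centred Z_in_lin) auto
      have "expectation (\<lambda>\<omega>. \<bar>Z d N \<omega>\<bar>) = sqrt (2 / pi) * (real N * d) powr H"
        using G.abs_moment[OF Z_in_lin, of d N] Z_variance[of d N] d
        by (simp add: powr_half_sqrt[symmetric] powr_powr)
      moreover have "expectation (\<lambda>\<omega>. (Z d N \<omega> + \<bar>Z d N \<omega>\<bar>) / 2) = expectation (\<lambda>\<omega>. \<bar>Z d N \<omega>\<bar>) / 2"
        using int E0 by simp
      moreover have "expectation (\<lambda>\<omega>. (Z d N \<omega> + \<bar>Z d N \<omega>\<bar>) / 2) \<le> expectation (run_max d N)"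
      proof (rule integral_mono)
        fix \<omega>
        have "Z d N \<omega> \<le> run_max d N \<omega>" "Z d 0 \<omega> \<le> run_max d N \<omega>"
          unfolding run_max_def by (auto intro!: Max_ge simp del: Z_0)
        then show "(Z d N \<omega> + \<bar>Z d N \<omega>\<bar>) / 2 \<le> run_max d N \<omega>"
          by simp
      qed (use int d in \<open>auto intro: run_max_integrable\<close>)
      ultimately show ?thesis
        by (simp add: N_def \<kappa>_def)
    qed
    moreover have "expectation (run_max d (K * n)) \<le>
        run_max_const * (real n * d) powr H + real (K * n) * expectation (pos_min d n)"
    proof -
      obtain p where p: "K * n = n + p"
        using K le_Suc_ex[of n "K * n"] by auto
      have "expectation (run_max d (K * n)) =
          (\<Sum>k=1..n. expectation (pos_min d k)) + (\<Sum>k=n+1..K * n. expectation (pos_min d k))"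
        unfolding expectation_run_max[OF less_imp_le[OF d]] p by (rule sum.ub_add_nat) simp
      also have "(\<Sum>k=n+1..K * n. expectation (pos_min d k)) \<le> (\<Sum>k=n+1..K * n. expectation (pos_min d n))"
        using d n by (intro sum_mono pos_min_antimono) auto
      also have "\<dots> = real (K * n - n) * expectation (pos_min d n)"
        by simp
      also have "\<dots> \<le> real (K * n) * expectation (pos_min d n)"
        by (intro mult_right_mono of_nat_mono integral_nonneg_AE) (auto simp: pos_min_nonneg)
      also have "(\<Sum>k=1..n. expectation (pos_min d k)) \<le> run_max_const * (real n * d) powr H"
        using expectation_run_max_le[OF d n] d by (simp add: expectation_run_max)
      finally show ?thesis
        by simp
    qed
    moreover have "(run_max_const + 1) * (real n * d) powr H \<le> \<kappa> * (real (K * n) * d) powr H"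
      using mult_right_mono[OF KH, of "(real n * d) powr H"] d
      by (simp add: powr_mult mult.assoc)
    ultimately have "(real n * d) powr H \<le> real (K * n) * expectation (pos_min d n)"
      by (simp add: algebra_simps)
    then show "1 / real K * ((real n * d) powr H / real n) \<le> expectation (pos_min d n)"
      using K n by (simp add: field_simps)
  qed (use K in simp)
qed

end

subsection \<open>Persistence probabilities\<close>

text \<open>For \<open>p = 2 * H\<close> this says that the first unit increment is nonnegatively
  correlated with the increments after it; the assumption \<open>1 / 2 \<le> H\<close> enters the
  upper bound here.\<close>

lemma powr_Suc_superadditive:
  assumes "1 \<le> p" "1 \<le> k"
  shows "real k powr p + 1 \<le> (real k + 1) powr p"
proof -
  have "real k powr p + 1 = real k * real k powr (p - 1) + 1"
    using assms by (simp add: powr_mult_base)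
  also have "\<dots> \<le> real k * (real k + 1) powr (p - 1) + (real k + 1) powr (p - 1)"
    using assms by (intro add_mono mult_left_mono powr_mono2 ge_one_powr_ge_zero) auto
  also have "\<dots> = (real k + 1) * (real k + 1) powr (p - 1)"
    by (simp add: algebra_simps)
  also have "\<dots> = (real k + 1) powr p"
    by (simp add: powr_mult_base)
  finally show ?thesis .
qed

context fractional_brownian_motion
begin

lemma path_continuous: "\<omega> \<in> space M \<Longrightarrow> A \<subseteq> {0..} \<Longrightarrow> continuous_on A (\<lambda>t. B t \<omega>)"
  using continuous_paths continuous_on_subset by blast

lemma path_SUP_le_iff:
  assumes "\<omega> \<in> space M" "0 \<le> T"
  shows "(SUP t\<in>{0..T}. B t \<omega>) \<le> a \<longleftrightarrow> (\<forall>t\<in>{0..T}. B t \<omega> \<le> a)"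
proof -
  have "compact ((\<lambda>t. B t \<omega>) ` {0..T})"
    using assms by (intro compact_continuous_image path_continuous) auto
  then have "bdd_above ((\<lambda>t. B t \<omega>) ` {0..T})"
    by (intro bounded_imp_bdd_above compact_imp_bounded)
  then show ?thesis
    using assms by (intro cSUP_le_iff) auto
qed

text \<open>By continuity it suffices to test the rational times in the open interval, whose closure
  is \<open>{0..T}\<close>; there are only countably many of them.\<close>

lemma persistence_event_measurable:
  assumes "0 < T"
  shows "{\<omega> \<in> space M. \<forall>t\<in>{0..T}. B t \<omega> \<le> a} \<in> events"
proof -
  let ?Q = "{0<..<T} \<inter> \<rat>"
  have "closure {0<..<T} \<subseteq> closure ?Q"
    using open_Int_closure_subset[of "{0<..<T}" "\<rat>"] by (simp add: Rats_closure_real closure_minimal)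
  then have cl: "{0..T} \<subseteq> closure ?Q"
    using assms by simp
  have "closure ?Q \<subseteq> closure {0<..<T}"
    by (intro closure_mono) auto
  then have "closure ?Q \<subseteq> {0..T}"
    using assms by simp
  have "(\<forall>t\<in>{0..T}. B t \<omega> \<le> a) \<longleftrightarrow> (\<forall>t\<in>?Q. B t \<omega> \<le> a)" if "\<omega> \<in> space M" for \<omega>
  proof
    assume *: "\<forall>t\<in>?Q. B t \<omega> \<le> a"
    have "closure ?Q \<subseteq> {0..}"
      using \<open>closure ?Q \<subseteq> {0..T}\<close> by auto
    then have "continuous_on (closure ?Q) (\<lambda>t. B t \<omega>)"
      using that path_continuous by blast
    then show "\<forall>t\<in>{0..T}. B t \<omega> \<le> a"
      using cl * continuous_le_on_closure[of ?Q "\<lambda>t. B t \<omega>" _ a] by blast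
  qed auto
  then have "{\<omega> \<in> space M. \<forall>t\<in>{0..T}. B t \<omega> \<le> a} = {\<omega> \<in> space M. \<forall>t\<in>?Q. B t \<omega> \<le> a}"
    by blast
  also have "\<dots> \<in> events"
  proof -
    let ?R = "{x. of_rat x \<in> {0<..<T}}"
    have "Measurable.pred M (\<lambda>\<omega>. B (of_rat x) \<omega> \<le> a)" if "x \<in> ?R" for x
    proof -
      have [measurable]: "B (of_rat x) \<in> borel_measurable M"
        using that by (intro G.measurable lin_base) auto
      show ?thesis
        by measurable
    qed
    then have "Measurable.pred M (\<lambda>\<omega>. \<forall>x\<in>?R. B (of_rat x) \<omega> \<le> a)"
      by (rule pred_intros_countable_bounded(3))
    then have "{\<omega> \<in> space M. \<forall>x\<in>?R. B (of_rat x) \<omega> \<le> a} \<in> events"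
      by (rule predE)
    moreover have "?Q = of_rat ` ?R"
      unfolding Rats_def by blast
    then have "(\<forall>t\<in>?Q. P t) \<longleftrightarrow> (\<forall>x\<in>?R. P (of_rat x))" for P
      by (metis (no_types, lifting) imageE imageI)
    ultimately show ?thesis
      by (simp only:)
  qed
  finally show ?thesis .
qed

section \<open>Upper bound through the mesh of width 1\<close>

lemma Z_1_measurable [measurable]: "Z 1 k \<in> borel_measurable M"
  by simp

definition persistence :: "real \<Rightarrow> real \<Rightarrow> real" where
  "persistence T a = prob {\<omega> \<in> space M. (SUP t\<in>{0..T}. B t \<omega>) \<le> a}"

lemma persistence_eq:
  "0 \<le> T \<Longrightarrow> persistence T a = prob {\<omega> \<in> space M. \<forall>t\<in>{0..T}. B t \<omega> \<le> a}"
  unfolding persistence_def using path_SUP_le_iff by (intro arg_cong[of _ _ prob]) auto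

text \<open>Stationarity and symmetry combined: the increments after time 1 have the joint law of
  the reflected mesh values. This frees \<open>Z 1 1\<close> to be used as an additional initial
  step.\<close>

lemma prob_Z_shift_atLeast:
  "prob {\<omega> \<in> space M. \<forall>k\<in>{1..n}. - a \<le> Z 1 (Suc k) \<omega> - Z 1 1 \<omega>} =
   prob {\<omega> \<in> space M. \<forall>k\<in>{1..n}. Z 1 k \<omega> \<le> a}"
proof -
  have "distr M (Pi\<^sub>M {1..n} (\<lambda>_. borel)) (\<lambda>\<omega>. \<lambda>k\<in>{1..n}. Z 1 (Suc k) \<omega> - Z 1 1 \<omega>) =
    distr M (Pi\<^sub>M {1..n} (\<lambda>_. borel)) (\<lambda>\<omega>. \<lambda>k\<in>{1..n}. - Z 1 k \<omega>)"
  proof (rule gaussian_distr_PiM_eq)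
    fix i j assume "i \<in> {1..n}" "j \<in> {1..n}"
    then show "expectation (\<lambda>\<omega>. (Z 1 (Suc i) \<omega> - Z 1 1 \<omega>) * (Z 1 (Suc j) \<omega> - Z 1 1 \<omega>)) =
        expectation (\<lambda>\<omega>. (- Z 1 i \<omega>) * (- Z 1 j \<omega>))"
      using Z_diff_covariance[of 1 "Suc i" 1 "Suc j" 1] Z_diff_covariance[of 1 i 0 j 0]
      by simp
  qed (auto intro!: G.diff G.minus Z_in_lin G.centred_gaussian_space_axioms)
  then show ?thesis
  proof (rule prob_eq_if_distr_PiM_eq[where P = "\<lambda>x. \<forall>k\<in>{1..n}. - a \<le> x k"])
    show "Measurable.pred (Pi\<^sub>M {1..n} (\<lambda>_. borel)) (\<lambda>x. \<forall>k\<in>{1..n}. - a \<le> (x k :: real))"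
      by measurable
  qed (auto intro!: G.measurable G.diff G.minus Z_in_lin)
qed

lemma prob_Z_atLeast_1_le:
  "prob {\<omega> \<in> space M. \<forall>k\<in>{1..Suc n}. 1 \<le> Z 1 k \<omega>} \<le> expectation (pos_min 1 (Suc n))"
proof -
  let ?E = "{\<omega> \<in> space M. \<forall>k\<in>{1..Suc n}. 1 \<le> Z 1 k \<omega>}"
  have E: "?E \<in> events"
    by measurable
  then have "prob ?E = expectation (indicator ?E)"
    by simp
  also have "\<dots> \<le> expectation (pos_min 1 (Suc n))"
  proof (rule integral_mono)
    show "indicator ?E \<omega> \<le> pos_min 1 (Suc n) \<omega>" for \<omega>
    proof (cases "\<omega> \<in> ?E")
      case True
      then have "1 \<le> Min ((\<lambda>k. Z 1 k \<omega>) ` {1..Suc n})"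
        by (subst Min_ge_iff) auto
      then have "1 \<le> pos_min 1 (Suc n) \<omega>"
        unfolding pos_min_def by (rule max.coboundedI2)
      then show ?thesis
        using True by simp
    qed (use pos_min_nonneg in auto)
  qed (use E in \<open>auto intro!: pos_min_integrable simp: less_top[symmetric]\<close>)
  finally show ?thesis .
qed

lemma persistence_upper:
  assumes H: "1 / 2 \<le> H" and T: "1 \<le> T" and a: "0 \<le> a"
  shows "prob {\<omega> \<in> space M. 1 + a \<le> Z 1 1 \<omega>} * persistence T a \<le> run_max_const * T powr (- (1 - H))"
proof -
  \<comment> \<open>The points \<open>1, ..., n\<close> lie in \<open>{0..T}\<close>, and the
    additional initial step makes \<open>Suc n\<close> points. Since \<open>Suc n\<close> is at
    least \<open>T\<close>, the decreasing power at the end can be compared with that of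
    \<open>T\<close>.\<close>
  define n where "n = nat \<lfloor>T\<rfloor>"
  have n: "real n \<le> T" "T \<le> real (Suc n)"
    using T by (auto simp: n_def) linarith
  have "persistence T a \<le> prob {\<omega> \<in> space M. \<forall>k\<in>{1..n}. Z 1 k \<omega> \<le> a}"
    unfolding persistence_eq[OF order_trans[OF zero_le_one T]]
  proof (rule finite_measure_mono_AE)
    show "AE \<omega> in M. \<omega> \<in> {\<omega> \<in> space M. \<forall>t\<in>{0..T}. B t \<omega> \<le> a} \<longrightarrow>
        \<omega> \<in> {\<omega> \<in> space M. \<forall>k\<in>{1..n}. Z 1 k \<omega> \<le> a}"
      using B_0
    proof eventually_elim
      case (elim \<omega>)
      have "real k \<le> T" if "k \<le> n" for k
        using n(1) that by linarith
      with elim show ?case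
        by (auto simp: Z_def)
    qed
    show "{\<omega> \<in> space M. \<forall>k\<in>{1..n}. Z 1 k \<omega> \<le> a} \<in> events"
      by measurable
  qed
  then have "prob {\<omega> \<in> space M. 1 + a \<le> Z 1 1 \<omega>} * persistence T a \<le>
    prob {\<omega> \<in> space M. 1 + a \<le> Z 1 1 \<omega>} *
    prob {\<omega> \<in> space M. \<forall>k\<in>{1..n}. - a \<le> Z 1 (Suc k) \<omega> - Z 1 1 \<omega>}"
    unfolding prob_Z_shift_atLeast by (intro mult_left_mono) auto
  also have "\<dots> \<le> prob {\<omega> \<in> space M. 1 + a \<le> Z 1 1 \<omega> \<and>
      (\<forall>k\<in>{1..n}. - a \<le> Z 1 (Suc k) \<omega> - Z 1 1 \<omega>)}"
  proof (rule G.prob_atLeast_associated)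
    show "0 < expectation (\<lambda>\<omega>. (Z 1 1 \<omega>)\<^sup>2)"
      by (simp add: Z_variance)
    show "0 \<le> expectation (\<lambda>\<omega>. Z 1 1 \<omega> * (Z 1 (Suc k) \<omega> - Z 1 1 \<omega>))" if "k \<in> {1..n}" for k
      using Z_diff_covariance[of 1 1 0 "Suc k" 1] powr_Suc_superadditive[of "2 * H" k] H that
      by (simp add: add.commute)
  qed (auto intro!: G.diff Z_in_lin)
  also have "\<dots> \<le> prob {\<omega> \<in> space M. \<forall>k\<in>{1..Suc n}. 1 \<le> Z 1 k \<omega>}"
  proof (rule finite_measure_mono)
    show "{\<omega> \<in> space M. \<forall>k\<in>{1..Suc n}. 1 \<le> Z 1 k \<omega>} \<in> events"
      by measurable
    show "{\<omega> \<in> space M. 1 + a \<le> Z 1 1 \<omega> \<and> (\<forall>k\<in>{1..n}. - a \<le> Z 1 (Suc k) \<omega> - Z 1 1 \<omega>)}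
      \<subseteq> {\<omega> \<in> space M. \<forall>k\<in>{1..Suc n}. 1 \<le> Z 1 k \<omega>}"
    proof safe
      fix \<omega> k
      assume *: "1 + a \<le> Z 1 1 \<omega>" "\<forall>k\<in>{1..n}. - a \<le> Z 1 (Suc k) \<omega> - Z 1 1 \<omega>" "k \<in> {1..Suc n}"
      then obtain j where j: "k = Suc j" "j \<le> n"
        by (cases k) auto
      show "1 \<le> Z 1 k \<omega>"
      proof (cases "j = 0")
        case True
        then show ?thesis
          using * j a by simp
      next
        case False
        then show ?thesis
          using *(1) bspec[OF *(2), of j] j by simp
      qed
    qed
  qed
  also have "\<dots> \<le> expectation (pos_min 1 (Suc n))"
    by (rule prob_Z_atLeast_1_le)
  also have "\<dots> \<le> run_max_const * (real (Suc n) powr H / real (Suc n))"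
    using pos_min_upper[of 1 "Suc n"] by simp
  also have "real (Suc n) powr H / real (Suc n) = real (Suc n) powr (- (1 - H))"
    by (simp add: powr_diff)
  also have "run_max_const * real (Suc n) powr (- (1 - H)) \<le> run_max_const * T powr (- (1 - H))"
    using run_max_const_pos n T hurst_parameter by (intro mult_left_mono powr_mono2') auto
  finally show ?thesis .
qed

text \<open>Since \<open>pos_min\<close> is at most \<open>\<bar>Z d 1\<bar>\<close>, it is cut off at \<open>exp 1 * sqrt q * d powr H\<close>; the moment of
  order \<open>2 * q\<close> of \<open>Z d 1\<close> bounds the excess.\<close>

lemma pos_min_le_prob_positive:
  assumes d: "0 < d" and n: "1 \<le> n" and q: "0 < q"
  shows "expectation (pos_min d n) \<le> exp 1 * sqrt (real q) * d powr H *
    (prob {\<omega> \<in> space M. \<forall>k\<in>{1..n}. 0 < Z d k \<omega>} + exp (- 2 * real q))"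
proof -
  \<comment> \<open>The moment of order \<open>2 * q\<close> of \<open>Z d 1\<close> is at most the
    same power of \<open>sqrt q * d powr H\<close>; the factor \<open>exp 1\<close> turns this into
    the error \<open>exp (- 2 * q)\<close>.\<close>
  define L where "L = exp 1 * sqrt (real q) * d powr H"
  have L: "0 < L"
    using d q by (simp add: L_def)
  let ?E = "{\<omega> \<in> space M. \<forall>k\<in>{1..n}. 0 < Z d k \<omega>}"
  have [measurable]: "Z d k \<in> borel_measurable M" for k
    using d by simp
  have E: "?E \<in> events"
    by measurable
  have "pos_min d n \<omega> \<le> L * indicator ?E \<omega> + L * (Z d 1 \<omega> / L) ^ (2 * q)" if \<omega>: "\<omega> \<in> space M" for \<omega>
  proof (cases "\<omega> \<in> ?E")
    case True
    from le_one_plus_even_power[OF q, of "\<bar>Z d 1 \<omega>\<bar> / L"] have "\<bar>Z d 1 \<omega>\<bar> \<le> L * (1 + (\<bar>Z d 1 \<omega>\<bar> / L) ^ (2 * q))"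
      using L by (simp add: field_simps)
    then show ?thesis
      using True pos_min_le[OF n, of d \<omega>] by (simp add: distrib_left power_divide power_even_abs)
  next
    case False
    then obtain k where k: "k \<in> {1..n}" "Z d k \<omega> \<le> 0"
      using \<omega> by (auto simp: not_less)
    then have "Min ((\<lambda>k. Z d k \<omega>) ` {1..n}) \<le> 0"
      by (subst Min_le_iff) auto
    then have "pos_min d n \<omega> = 0"
      by (simp add: pos_min_def)
    then show ?thesis
      using False L by (simp add: zero_le_even_power')
  qed
  moreover have int: "integrable M (\<lambda>\<omega>. (Z d 1 \<omega> / L) ^ (2 * q))"
    unfolding power_divide using d by (intro integrable_divide_zero G.integrable_power Z_in_lin) auto
  moreover have intE: "integrable M (indicator ?E :: 'a \<Rightarrow> real)"
    using E by (simp add: less_top[symmetric])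
  ultimately have "expectation (pos_min d n) \<le>
      expectation (\<lambda>\<omega>. L * indicator ?E \<omega> + L * (Z d 1 \<omega> / L) ^ (2 * q))"
    using d n by (intro integral_mono pos_min_integrable) auto
  also have "\<dots> = L * prob ?E + L * expectation (\<lambda>\<omega>. (Z d 1 \<omega> / L) ^ (2 * q))"
    using E int intE by simp
  also have "expectation (\<lambda>\<omega>. (Z d 1 \<omega> / L) ^ (2 * q)) \<le> exp (- 2 * real q)"
  proof -
    have "expectation (\<lambda>\<omega>. (Z d 1 \<omega> / L) ^ (2 * q)) = expectation (\<lambda>\<omega>. (Z d 1 \<omega>) ^ (2 * q)) / L ^ (2 * q)"
      by (simp add: power_divide)
    also have "\<dots> \<le> (real q * d powr (2 * H)) ^ q / L ^ (2 * q)"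
      using G.even_moment[OF Z_in_lin, of d q 1] Z_variance[of d 1] d q L
      by (intro divide_right_mono) auto
    also have "L ^ (2 * q) = (real q * d powr (2 * H)) ^ q * exp (2 * real q)"
    proof -
      have "L ^ 2 = real q * d powr (2 * H) * exp 2"
        using d exp_double[of "1::real"] by (simp add: L_def power_mult_distrib powr_power)
      then have "L ^ (2 * q) = (real q * d powr (2 * H)) ^ q * exp 2 ^ q"
        by (simp only: power_mult power_mult_distrib)
      also have "exp 2 ^ q = exp (2 * real q)"
        using exp_of_nat_mult[of q "2::real"] by (simp add: mult.commute)
      finally show ?thesis .
    qed
    also have "(real q * d powr (2 * H)) ^ q / ((real q * d powr (2 * H)) ^ q * exp (2 * real q)) = exp (- 2 * real q)"
      using d q by (simp add: exp_minus field_simps)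
    finally show ?thesis .
  qed
  finally show ?thesis
    using L by (simp add: L_def[symmetric] distrib_left)
qed

text \<open>Needed because \<open>pos_min\<close> controls positive mesh paths, while the
  persistence event asks for paths that stay low.\<close>

lemma prob_Z_negative:
  assumes "0 \<le> d"
  shows "prob {\<omega> \<in> space M. \<forall>k\<in>{1..n}. Z d k \<omega> < 0} = prob {\<omega> \<in> space M. \<forall>k\<in>{1..n}. 0 < Z d k \<omega>}"
proof -
  have "distr M (Pi\<^sub>M {1..n} (\<lambda>_. borel)) (\<lambda>\<omega>. \<lambda>k\<in>{1..n}. - Z d k \<omega>) =
    distr M (Pi\<^sub>M {1..n} (\<lambda>_. borel)) (\<lambda>\<omega>. \<lambda>k\<in>{1..n}. Z d k \<omega>)"
    by (rule gaussian_distr_PiM_eq)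
       (use assms in \<open>auto intro!: G.minus Z_in_lin G.centred_gaussian_space_axioms\<close>)
  then show ?thesis
  proof (rule prob_eq_if_distr_PiM_eq[where P = "\<lambda>x. \<forall>k\<in>{1..n}. 0 < x k"])
    show "Measurable.pred (Pi\<^sub>M {1..n} (\<lambda>_. borel)) (\<lambda>x. \<forall>k\<in>{1..n}. 0 < (x k :: real))"
      by measurable
  qed (use assms in \<open>auto intro!: G.measurable G.minus Z_in_lin\<close>)
qed

text \<open>Phrased through chain sums instead of the path, this is a countable union of events
  accessible to Markov's inequality. Chain sums are nondecreasing in the level \<open>m\<close>, so
  a bound uniform in \<open>m\<close> passes to the union.\<close>

definition fluctuates :: "real \<Rightarrow> real \<Rightarrow> nat \<Rightarrow> real \<Rightarrow> 'a set" where
  "fluctuates s d q a = (\<Union>m. {\<omega> \<in> space M. a ^ (2 * q) \<le> chain s d q m \<omega>})"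

lemma
  assumes "0 \<le> s" "0 < d" "0 < q"
  shows fluctuates_measurable: "fluctuates s d q a \<in> events"
    and prob_fluctuates: "0 < a \<Longrightarrow> 2 \<le> H * q \<Longrightarrow>
      prob (fluctuates s d q a) \<le> 2 * (sqrt (real q) * d powr H / ((1 - r) * a)) ^ (2 * q)"
proof -
  define A where "A m = {\<omega> \<in> space M. a ^ (2 * q) \<le> chain s d q m \<omega>}" for m
  have [measurable]: "chain s d q m \<in> borel_measurable M" for m
    using chain_integrable[OF assms] by auto
  have A: "A m \<in> events" for m
    unfolding A_def by measurable
  then show "fluctuates s d q a \<in> events"
    by (auto simp: fluctuates_def A_def)
  assume a: "0 < a" and q: "2 \<le> H * q"
  have "prob (A m) \<le> 2 * (sqrt (real q) * d powr H / ((1 - r) * a)) ^ (2 * q)" for m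
  proof -
    have "prob (A m) \<le> expectation (chain s d q m) / a ^ (2 * q)"
      unfolding A_def using a chain_integrable[OF assms]
      by (intro integral_Markov_inequality_measure[where A = "{}"]) (auto simp: chain_nonneg)
    also have "\<dots> \<le> 2 * real q ^ q * (d powr H / (1 - r)) ^ (2 * q) / a ^ (2 * q)"
      using a assms q by (intro divide_right_mono chain_expectation) auto
    also have "real q ^ q = sqrt (real q) ^ (2 * q)"
      by (simp add: power_mult)
    finally show ?thesis
      by (simp add: power_mult_distrib power_divide mult_ac)
  qed
  moreover have "incseq A"
    unfolding A_def incseq_def using chain_mono order_trans by blast
  then have "(\<lambda>m. prob (A m)) \<longlonglongrightarrow> prob (\<Union>m. A m)"
    using A by (intro finite_Lim_measure_incseq) auto
  ultimately have "prob (\<Union>m. A m) \<le> 2 * (sqrt (real q) * d powr H / ((1 - r) * a)) ^ (2 * q)"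
    by (intro LIMSEQ_le_const2[of "\<lambda>m. prob (A m)"]) auto
  then show "prob (fluctuates s d q a) \<le> 2 * (sqrt (real q) * d powr H / ((1 - r) * a)) ^ (2 * q)"
    by (simp add: fluctuates_def A_def)
qed

text \<open>Dyadic points \<open>\<tau> m\<close> within \<open>d / 2 ^ m\<close> to the left of
  \<open>t\<close> satisfy the bound, and continuity of the path carries it over to
  \<open>t\<close>.\<close>

lemma not_fluctuates_increment_le:
  assumes \<omega>: "\<omega> \<in> space M" "\<omega> \<notin> fluctuates s d q a" and s: "0 \<le> s" "0 < d" "0 < q" and a: "0 < a"
    and t: "s \<le> t" "t \<le> s + d"
  shows "B t \<omega> - B s \<omega> \<le> a"
proof -
  define k where "k m = nat \<lfloor>(t - s) / d * 2 ^ m\<rfloor>" for m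
  define \<tau> where "\<tau> m = s + real (k m) * d / 2 ^ m" for m
  have k: "real (k m) \<le> (t - s) / d * 2 ^ m" "(t - s) / d * 2 ^ m - 1 \<le> real (k m)" for m
  proof -
    have "0 \<le> (t - s) / d * 2 ^ m"
      using s t by simp
    then show "real (k m) \<le> (t - s) / d * 2 ^ m" "(t - s) / d * 2 ^ m - 1 \<le> real (k m)"
      unfolding k_def by linarith+
  qed
  have "k m \<le> 2 ^ m" for m
  proof -
    have "(t - s) / d * 2 ^ m \<le> 1 * 2 ^ m"
      using s t by (intro mult_right_mono) auto
    then have "real (k m) \<le> 2 ^ m"
      using k(1)[of m] by linarith
    then show ?thesis
      by simp
  qed
  have le: "B (\<tau> m) \<omega> - B s \<omega> \<le> a" for m
  proof -
    have "(B (\<tau> m) \<omega> - B s \<omega>) ^ (2 * q) \<le> chain s d q m \<omega>"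
      unfolding \<tau>_def using \<open>k m \<le> 2 ^ m\<close> s by (intro increment_le_chain)
    also have "\<dots> < a ^ (2 * q)"
      using \<omega> by (auto simp: fluctuates_def not_le)
    finally show ?thesis
      using power_mono[of a "B (\<tau> m) \<omega> - B s \<omega>" "2 * q"] a by linarith
  qed
  have "\<tau> \<longlonglongrightarrow> t"
  proof (rule tendsto_sandwich[OF always_eventually always_eventually])
    show "\<forall>m. t - d / 2 ^ m \<le> \<tau> m"
    proof
      fix m
      have "((t - s) / d * 2 ^ m - 1) * (d / 2 ^ m) \<le> real (k m) * (d / 2 ^ m)"
        using k(2)[of m] s by (intro mult_right_mono) auto
      moreover have "((t - s) / d * 2 ^ m - 1) * (d / 2 ^ m) = t - s - d / 2 ^ m"
        using s by (simp add: field_simps)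
      ultimately show "t - d / 2 ^ m \<le> \<tau> m"
        by (simp add: \<tau>_def)
    qed
    show "\<forall>m. \<tau> m \<le> t"
    proof
      fix m
      have "real (k m) * (d / 2 ^ m) \<le> (t - s) / d * 2 ^ m * (d / 2 ^ m)"
        using k(1)[of m] s by (intro mult_right_mono) auto
      also have "\<dots> = t - s"
        using s by (simp add: field_simps)
      finally show "\<tau> m \<le> t"
        by (simp add: \<tau>_def)
    qed
    have "(\<lambda>m. t - d * (1 / 2) ^ m) \<longlonglongrightarrow> t - d * 0"
      by (intro tendsto_intros LIMSEQ_power_zero) auto
    then show "(\<lambda>m. t - d / 2 ^ m) \<longlonglongrightarrow> t"
      by (simp add: power_divide)
  qed auto
  moreover have "\<tau> m \<in> {0..}" for m
    using s by (simp add: \<tau>_def)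
  ultimately have "(\<lambda>m. B (\<tau> m) \<omega> - B s \<omega>) \<longlonglongrightarrow> B t \<omega> - B s \<omega>"
    using continuous_paths[OF \<omega>(1)] s t
    by (intro tendsto_diff tendsto_const continuous_on_tendsto_compose[of "{0..}" "\<lambda>t. B t \<omega>"])
       auto
  with le show ?thesis
    by (intro LIMSEQ_le_const2[of _ "B t \<omega> - B s \<omega>"]) auto
qed

text \<open>Threshold 0 on the mesh leaves the whole height \<open>a\<close> for the movement after
  a mesh point. A path that is negative on the mesh and does not fluctuate therefore stays below
  \<open>a\<close>, up to the null set where \<open>B 0\<close> is not 0.\<close>

lemma persistence_ge_discrete:
  assumes T: "0 < T" and d: "0 < d" and q: "0 < q" "2 \<le> H * q" and a: "0 < a"
    and n: "T \<le> real n * d"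
  shows "prob {\<omega> \<in> space M. \<forall>k\<in>{1..n}. Z d k \<omega> < 0} \<le>
    persistence T a + real (Suc n) * (2 * (sqrt (real q) * d powr H / ((1 - r) * a)) ^ (2 * q))"
proof -
  \<comment> \<open>The index \<open>k = n\<close> is included because \<open>t = T = n * d\<close>
    is possible; this gives the factor \<open>Suc n\<close>.\<close>
  define F where "F = (\<Union>k\<le>n. fluctuates (real k * d) d q a)"
  define S where "S = {\<omega> \<in> space M. \<forall>t\<in>{0..T}. B t \<omega> \<le> a}"
  have S: "S \<in> events"
    unfolding S_def using T by (rule persistence_event_measurable)
  have F: "F \<in> events"
    unfolding F_def using d q by (intro sets.finite_UN fluctuates_measurable) auto
  have "prob {\<omega> \<in> space M. \<forall>k\<in>{1..n}. Z d k \<omega> < 0} \<le> prob (S \<union> F)"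
  proof (rule finite_measure_mono_AE)
    show "AE \<omega> in M. \<omega> \<in> {\<omega> \<in> space M. \<forall>k\<in>{1..n}. Z d k \<omega> < 0} \<longrightarrow> \<omega> \<in> S \<union> F"
      using B_0
    proof eventually_elim
      case (elim \<omega>)
      have "B t \<omega> \<le> a" if \<omega>: "\<omega> \<in> space M" "\<forall>k\<in>{1..n}. Z d k \<omega> < 0" "\<omega> \<notin> F" and t: "t \<in> {0..T}" for t
      proof -
        define k where "k = nat \<lfloor>t / d\<rfloor>"
        have "0 \<le> t / d"
          using t d by simp
        then have "real k \<le> t / d" "t / d \<le> real k + 1"
          unfolding k_def by linarith+
        then have kd: "real k * d \<le> t" "t \<le> real k * d + d"
          using d by (auto simp: field_simps)
        have "real k * d \<le> real n * d"
          using kd(1) t n by auto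
        then have "k \<le> n"
          using d by simp
        have "B (real k * d) \<omega> \<le> 0"
        proof (cases "k = 0")
          case False
          then have "Z d k \<omega> < 0"
            using \<omega>(2) \<open>k \<le> n\<close> by simp
          then show ?thesis
            by (simp add: Z_def elim)
        qed (simp add: elim)
        moreover have "B t \<omega> - B (real k * d) \<omega> \<le> a"
          using \<omega> \<open>k \<le> n\<close> d q a kd by (intro not_fluctuates_increment_le[of \<omega> _ d q]) (auto simp: F_def)
        ultimately show ?thesis
          by simp
      qed
      then show ?case
        by (auto simp: S_def)
    qed
  qed (use S F in auto)
  also have "\<dots> \<le> prob S + prob F"
    using S F by (rule measure_Un_le)
  also have "prob F \<le> (\<Sum>k\<le>n. prob (fluctuates (real k * d) d q a))"
    unfolding F_def using d q by (intro measure_UNION_le) (auto intro: fluctuates_measurable)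
  also have "\<dots> \<le> (\<Sum>k\<le>n. 2 * (sqrt (real q) * d powr H / ((1 - r) * a)) ^ (2 * q))"
    using d q a by (intro sum_mono prob_fluctuates) auto
  finally show ?thesis
    using T by (simp add: S_def persistence_eq)
qed

end

section \<open>Lower bound: mesh width against error terms\<close>

lemma eventually_powr_ln_powr_le:
  fixes h \<epsilon> :: real
  assumes "h > 0" "\<epsilon> > 0"
  shows "\<forall>\<^sub>F T in at_top. T powr (- 8) * ln T powr h \<le> \<epsilon>"
proof -
  have "((\<lambda>T. T powr (- 8) * ln T powr h) \<longlongrightarrow> 0) at_top"
    using assms(1) by real_asymp
  then have "\<forall>\<^sub>F T in at_top. T powr (- 8) * ln T powr h < \<epsilon>"
    using assms(2) by (rule order_tendstoD)
  then show ?thesis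
    by eventually_elim simp
qed

context fractional_brownian_motion
begin

text \<open>The mesh \<open>d\<close> is chosen such that both the fluctuation bound and the truncation error
  become \<open>exp (- 2 * q)\<close>, which is negligible because \<open>q \<ge> 5 * ln T\<close>. The logarithm in the
  theorem comes from \<open>d\<close>, which is of order \<open>ln T powr (- 1 / (2 * H))\<close>.\<close>

lemma persistence_lower:
  assumes a: "0 < a"
  obtains c where "0 < c"
    "\<forall>\<^sub>F T in at_top. c * T powr (- (1 - H)) * ln T powr (- (1 / (2 * H))) \<le> persistence T a"
proof -
  obtain c1 where c1: "c1 > 0"
    "\<And>d n. 0 < d \<Longrightarrow> 1 \<le> n \<Longrightarrow> c1 * ((real n * d) powr H / real n) \<le> expectation (pos_min d n)"
    by (rule pos_min_lower) blast
  \<comment> \<open>The mesh will satisfy \<open>sqrt q * d powr H = \<beta>\<close>. This value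
    makes the base of the fluctuation bound equal to \<open>exp (- 1)\<close>, so that its power
    \<open>2 * q\<close> matches the truncation error.\<close>
  define \<beta> where "\<beta> = (1 - r) * a / exp 1"
  have \<beta>: "\<beta> > 0"
    using r a by (simp add: \<beta>_def)
  define \<kappa> where "\<kappa> = c1 / (2 * exp 1 * \<beta>)"
  have \<kappa>: "\<kappa> > 0"
    using c1 \<beta> by (simp add: \<kappa>_def)
  define h where "h = 1 / (2 * H)"
  have h: "h > 0"
    using hurst_parameter by (simp add: h_def)
  \<comment> \<open>The constant in \<open>\<delta> * ln T powr (- h) \<le> d\<close>; the 6 stems
    from \<open>q \<le> 6 * ln T\<close>, where \<open>1 \<le> ln T\<close> absorbs the rounding of
    \<open>5 * ln T\<close>.\<close>
  define \<delta> where "\<delta> = \<beta> powr (1 / H) * 6 powr (- h)"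
  have \<delta>: "\<delta> > 0"
    using \<beta> by (simp add: \<delta>_def)
  have main: "\<kappa> * \<delta> / 2 * T powr (- (1 - H)) * ln T powr (- h) \<le> persistence T a"
    if T: "1 \<le> ln T" "2 / H \<le> ln T" "\<beta> powr (1 / H) \<le> T" "1 < T"
      and small: "T powr (- 8) * ln T powr (2 * h) \<le> \<kappa> * \<delta>\<^sup>2 / 14" for T
  proof -
    define q where "q = nat \<lceil>5 * ln T\<rceil>"
    have q: "5 * ln T \<le> real q" "real q \<le> 6 * ln T"
      using T(1) unfolding q_def by linarith+
    have q0: "0 < q" "1 \<le> real q"
      using q T(1) by linarith+
    have "2 / H \<le> real q"
      using q(1) T by linarith
    then have q2: "2 \<le> H * real q"
      using hurst_parameter by (simp add: field_simps)
    define d where "d = (\<beta> / sqrt (real q)) powr (1 / H)"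
    have d: "0 < d"
      using \<beta> q0 by (simp add: d_def)
    have dH: "d powr H = \<beta> / sqrt (real q)"
      using \<beta> hurst_parameter by (simp add: d_def powr_powr)
    have d_eq: "d = \<beta> powr (1 / H) * real q powr (- h)"
    proof -
      have "sqrt (real q) = real q powr (1 / 2)"
        using q0 by (simp add: powr_half_sqrt)
      then have "d = \<beta> powr (1 / H) / real q powr (1 / 2 * (1 / H))"
        using \<beta> q0 by (simp only: d_def powr_divide powr_powr)
      also have "1 / 2 * (1 / H) = h"
        by (simp add: h_def)
      finally show ?thesis
        by (simp add: powr_minus divide_inverse)
    qed
    have d_ge: "\<delta> * ln T powr (- h) \<le> d"
    proof -
      have "(6 * ln T) powr (- h) \<le> real q powr (- h)"
        using q q0 h by (intro powr_mono2') auto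
      then show ?thesis
        using T(1) by (simp add: d_eq \<delta>_def powr_mult mult.assoc mult_left_mono)
    qed
    have "d \<le> T"
    proof -
      have "real q powr (- h) \<le> 1 powr (- h)"
        using q0 h by (intro powr_mono2') auto
      then have "d \<le> \<beta> powr (1 / H) * 1"
        unfolding d_eq by (intro mult_left_mono) auto
      then show ?thesis
        using T by simp
    qed
    define n where "n = nat \<lceil>T / d\<rceil>"
    have "1 \<le> T / d"
      using \<open>d \<le> T\<close> d by simp
    then have n: "T / d \<le> real n" "real n \<le> 2 * (T / d)" "1 \<le> n"
      unfolding n_def by linarith+
    define P where "P = prob {\<omega> \<in> space M. \<forall>k\<in>{1..n}. Z d k \<omega> < 0}"
    have "c1 * ((real n * d) powr H / real n) \<le> exp 1 * sqrt (real q) * d powr H * (P + exp (- 2 * real q))"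
      using c1(2)[OF d n(3)] pos_min_le_prob_positive[OF d n(3) q0(1)] prob_Z_negative[of d n] d
      by (simp add: P_def)
    also have "\<dots> = exp 1 * \<beta> * (P + exp (- 2 * real q))"
      using q0 by (simp add: dH)
    finally have 1: "c1 * ((real n * d) powr H / real n) \<le> exp 1 * \<beta> * (P + exp (- 2 * real q))" .
    \<comment> \<open>The right-hand side is \<open>d powr H * n powr (- (1 - H))\<close>. Inserting
      \<open>n \<le> 2 * (T / d)\<close> releases another \<open>d powr (1 - H)\<close>, so a full
      factor \<open>d\<close> appears.\<close>
    have "d / 2 * T powr (- (1 - H)) \<le> (real n * d) powr H / real n"
    proof -
      have "d / 2 * T powr (- (1 - H)) \<le> d * 2 powr (- (1 - H)) * T powr (- (1 - H))"
      proof -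
        have "2 powr (- 1) \<le> (2::real) powr (- (1 - H))"
          using hurst_parameter by (intro powr_mono) auto
        then have "1 / 2 \<le> (2::real) powr (- (1 - H))"
          by (simp add: powr_minus)
        from mult_left_mono[OF this, of "d * T powr (- (1 - H))"] show ?thesis
          using d by (simp add: mult_ac)
      qed
      also have "\<dots> = d powr H * (2 * (T / d)) powr (- (1 - H))"
      proof -
        have "d powr H * d powr (1 - H) = d"
          using d by (simp add: powr_add[symmetric])
        moreover have "(2 * (T / d)) powr (- (1 - H)) = 2 powr (- (1 - H)) * T powr (- (1 - H)) * d powr (1 - H)"
        proof -
          have "(2 * (T / d)) powr e = 2 powr e * T powr e * (1 / d powr e)" for e
            using T d by (simp add: powr_mult powr_divide)
          from this[of "- (1 - H)"] show ?thesis
            using powr_minus_divide[of d "- (1 - H)"] by (simp only: minus_minus)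
        qed
        moreover have "x * (y * z * w) = (x * w) * y * z" for x y z w :: real
          by simp
        ultimately show ?thesis
          by (simp only:)
      qed
      also have "\<dots> \<le> d powr H * real n powr (- (1 - H))"
        using n hurst_parameter by (intro mult_left_mono powr_mono2') auto
      also have "\<dots> = (real n * d) powr H / real n"
        using n d by (simp add: powr_mult powr_diff)
      finally show ?thesis .
    qed
    then have "c1 * (d / 2 * T powr (- (1 - H))) \<le> c1 * ((real n * d) powr H / real n)"
      using c1(1) by (intro mult_left_mono) auto
    also note 1
    finally have "c1 * (d / 2 * T powr (- (1 - H))) \<le> exp 1 * \<beta> * (P + exp (- 2 * real q))" .
    then have P: "\<kappa> * d * T powr (- (1 - H)) \<le> P + exp (- 2 * real q)"
      using \<beta> by (simp add: \<kappa>_def field_simps)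
    have "P \<le> persistence T a + real (Suc n) * (2 * (sqrt (real q) * d powr H / ((1 - r) * a)) ^ (2 * q))"
      unfolding P_def using T d q0 q2 a n by (intro persistence_ge_discrete) (auto simp: field_simps)
    also have "(sqrt (real q) * d powr H / ((1 - r) * a)) ^ (2 * q) = exp (- 2 * real q)"
    proof -
      have "sqrt (real q) * d powr H / ((1 - r) * a) = exp (- 1)"
        using q0 r a by (simp add: dH \<beta>_def exp_minus field_simps)
      then show ?thesis
        using exp_of_nat_mult[of "2 * q" "- 1 :: real"] by simp
    qed
    finally have "\<kappa> * d * T powr (- (1 - H)) \<le> persistence T a + (2 * real n + 3) * exp (- 2 * real q)"
      using P by (simp add: algebra_simps)
    \<comment> \<open>The coefficient collects \<open>2 * Suc n\<close> from the fluctuations and 1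
      from the truncation; 7 is 4 + 3, by \<open>n \<le> 2 * (T / d)\<close> and
      \<open>1 \<le> T / d\<close>. The power of \<open>T\<close> comes from
      \<open>q \<ge> 5 * ln T\<close>.\<close>
    also have "(2 * real n + 3) * exp (- 2 * real q) \<le> 7 * (T / d) * T powr (- 10)"
    proof (rule mult_mono)
      show "2 * real n + 3 \<le> 7 * (T / d)"
        using n(2) \<open>1 \<le> T / d\<close> by linarith
      show "exp (- 2 * real q) \<le> T powr (- 10)"
        using q(1) T by (simp add: powr_def)
    qed (use T d in auto)
    also have "7 * (T / d) * T powr (- 10) = 7 * T powr (- 9) * (1 / d)"
    proof -
      have "T * T powr (- 10) = T powr (- 9)"
        using T by (simp add: powr_mult_base)
      then show ?thesis
        by (simp add: mult_ac)
    qed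
    also have "\<dots> \<le> 7 * T powr (- 9) * (ln T powr h / \<delta>)"
    proof -
      have "1 / d \<le> 1 / (\<delta> * ln T powr (- h))"
        using d_ge d \<delta> T(1) by (intro divide_left_mono mult_pos_pos) auto
      also have "\<dots> = ln T powr h / \<delta>"
        by (simp add: powr_minus field_simps)
      finally show ?thesis
        by (intro mult_left_mono) auto
    qed
    also have "\<dots> \<le> \<kappa> * \<delta> / 2 * T powr (- (1 - H)) * ln T powr (- h)"
    proof -
      \<comment> \<open>Since \<open>1 - H \<le> 1\<close>, eight powers of \<open>T\<close> are
        left to beat the logarithm. The bound in \<open>small\<close> is chosen so that the total
        error is at most half of the main term.\<close>
      have "T powr (- 9) \<le> T powr (- 8) * T powr (- (1 - H))"
        using T(4) hurst_parameter by (simp add: powr_add[symmetric] powr_mono)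
      moreover have "ln T powr h = ln T powr (2 * h) * ln T powr (- h)"
        by (simp add: powr_add[symmetric])
      ultimately have "7 * T powr (- 9) * (ln T powr h / \<delta>) \<le>
          7 * (T powr (- 8) * T powr (- (1 - H))) * (ln T powr (2 * h) * ln T powr (- h) / \<delta>)"
        using \<delta> by (simp add: divide_right_mono mult_right_mono)
      also have "\<dots> = (T powr (- 8) * ln T powr (2 * h)) * (7 / \<delta> * T powr (- (1 - H)) * ln T powr (- h))"
        by simp
      also have "\<dots> \<le> \<kappa> * \<delta>\<^sup>2 / 14 * (7 / \<delta> * T powr (- (1 - H)) * ln T powr (- h))"
        using small \<delta> by (intro mult_right_mono) auto
      also have "\<dots> = \<kappa> * \<delta> / 2 * T powr (- (1 - H)) * ln T powr (- h)"
        using \<delta> by (simp add: power2_eq_square)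
      finally show ?thesis .
    qed
    finally have "\<kappa> * d * T powr (- (1 - H)) \<le>
        persistence T a + \<kappa> * \<delta> / 2 * T powr (- (1 - H)) * ln T powr (- h)"
      by simp
    moreover have "\<kappa> * (\<delta> * ln T powr (- h)) * T powr (- (1 - H)) \<le> \<kappa> * d * T powr (- (1 - H))"
      using d_ge \<kappa> by (intro mult_right_mono mult_left_mono) auto
    ultimately show ?thesis
      by (simp add: algebra_simps)
  qed
  show ?thesis
  proof (rule that)
    show "0 < \<kappa> * \<delta> / 2"
      using \<kappa> \<delta> by simp
    have "\<forall>\<^sub>F T in at_top. x \<le> ln T" for x :: real
      using ln_at_top by (simp add: filterlim_at_top)
    note ev = this[of 1] this[of "2 / H"] eventually_ge_at_top[of "\<beta> powr (1 / H)"]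
      eventually_gt_at_top[of "1 :: real"]
    have "\<forall>\<^sub>F T in at_top. T powr (- 8) * ln T powr (2 * h) \<le> \<kappa> * \<delta>\<^sup>2 / 14"
      using h \<kappa> \<delta> by (intro eventually_powr_ln_powr_le) auto
    with ev have "\<forall>\<^sub>F T in at_top. \<kappa> * \<delta> / 2 * T powr (- (1 - H)) * ln T powr (- h) \<le> persistence T a"
      by eventually_elim (rule main)
    then show "\<forall>\<^sub>F T in at_top. \<kappa> * \<delta> / 2 * T powr (- (1 - H)) * ln T powr (- (1 / (2 * H))) \<le> persistence T a"
      by (simp add: h_def)
  qed
qed

end

theorem theorem12:
  fixes M :: "'a measure" and H :: real and B :: "real \<Rightarrow> 'a \<Rightarrow> real"
  assumes "fractional_brownian_motion M H B"
  shows "(1 / 2 < H \<and> H < 1 \<longrightarrow>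
      (\<forall>a>0. \<exists>c>0. \<forall>\<^sub>F T in at_top.
         inverse c * T powr (-(1 - H)) * ln T powr (- (1 / (2 * H)))
           \<le> measure M {\<omega> \<in> space M. (SUP t\<in>{0..T}. B t \<omega>) \<le> a} \<and>
         measure M {\<omega> \<in> space M. (SUP t\<in>{0..T}. B t \<omega>) \<le> a}
           \<le> c * T powr (-(1 - H)))) \<and>
    (\<forall>a>0. \<exists>c>0. \<forall>\<^sub>F T in at_top.
         inverse c * T powr (-(1 - H)) * ln T powr (- (1 / (2 * H)))
           \<le> measure M {\<omega> \<in> space M. (SUP t\<in>{0..T}. B t \<omega>) \<le> a})"
proof -
  interpret fractional_brownian_motion M H B by fact
  \<comment> \<open>Stated for all larger constants as well, so that the constant of the upper bound
    can be merged in by taking a maximum.\<close>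
  have lower: "\<exists>c>0. \<forall>C\<ge>c. \<forall>\<^sub>F T in at_top.
      inverse C * T powr (-(1 - H)) * ln T powr (- (1 / (2 * H))) \<le> persistence T a" if "0 < a" for a
  proof -
    obtain c where c: "0 < c"
      "\<forall>\<^sub>F T in at_top. c * T powr (- (1 - H)) * ln T powr (- (1 / (2 * H))) \<le> persistence T a"
      using \<open>0 < a\<close> by (rule persistence_lower)
    show ?thesis
    proof (intro exI[of _ "inverse c"] conjI allI impI)
      fix C assume "inverse c \<le> C"
      then have "inverse C \<le> c"
        using c(1) le_imp_inverse_le[of "inverse c" C] by simp
      then have "inverse C * T powr (- (1 - H)) * ln T powr (- (1 / (2 * H))) \<le>
          c * T powr (- (1 - H)) * ln T powr (- (1 / (2 * H)))" for T
        by (intro mult_right_mono) auto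
      with c(2) show "\<forall>\<^sub>F T in at_top.
          inverse C * T powr (-(1 - H)) * ln T powr (- (1 / (2 * H))) \<le> persistence T a"
        by (auto elim!: eventually_mono intro: order_trans)
    qed (use c in simp)
  qed
  have "\<exists>c>0. \<forall>\<^sub>F T in at_top.
      inverse c * T powr (-(1 - H)) * ln T powr (- (1 / (2 * H))) \<le> persistence T a \<and>
      persistence T a \<le> c * T powr (-(1 - H))" if "1 / 2 < H" "0 < a" for a
  proof -
    obtain c where c: "0 < c" "\<And>C. c \<le> C \<Longrightarrow> \<forall>\<^sub>F T in at_top.
        inverse C * T powr (-(1 - H)) * ln T powr (- (1 / (2 * H))) \<le> persistence T a"
      using lower[OF \<open>0 < a\<close>] by blast
    define p where "p = prob {\<omega> \<in> space M. 1 + a \<le> Z 1 1 \<omega>}"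
    have p: "0 < p"
      unfolding p_def by (intro G.prob_atLeast_pos Z_in_lin) (auto simp: Z_variance)
    define C where "C = max c (run_max_const / p)"
    have "c \<le> C" "run_max_const / p \<le> C"
      by (auto simp: C_def)
    have up: "persistence T a \<le> C * T powr (- (1 - H))" if "1 \<le> T" for T
    proof -
      have "p * persistence T a \<le> run_max_const * T powr (- (1 - H))"
        unfolding p_def using \<open>1 / 2 < H\<close> \<open>0 < a\<close> that by (intro persistence_upper) auto
      then have "persistence T a \<le> run_max_const / p * T powr (- (1 - H))"
        using p by (simp add: field_simps)
      also have "\<dots> \<le> C * T powr (- (1 - H))"
        using \<open>run_max_const / p \<le> C\<close> by (intro mult_right_mono) auto
      finally show ?thesis .
    qed
    have "\<forall>\<^sub>F T in at_top. inverse C * T powr (-(1 - H)) * ln T powr (- (1 / (2 * H))) \<le> persistence T a \<and>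
        persistence T a \<le> C * T powr (-(1 - H))"
      using c(2)[OF \<open>c \<le> C\<close>] eventually_ge_at_top[of 1] by eventually_elim (use up in auto)
    then show ?thesis
      using c(1) \<open>c \<le> C\<close> by (intro exI[of _ C]) auto
  qed
  then show ?thesis
    using lower unfolding persistence_def by blast
qed

end
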